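(* Let $\kappa$ be an infinite cardinal less than the continuum, and assume $BP(\kappa)$. Let $X$ be a connected, locally path connected $\kappa$-Polish space. Then the first singular homology group $H_1(X)$ has cardinality at most $\kappa$ or cardinality equal to the continuum.
   Context: A topological space is $\kappa$-separable if it has a dense subset of cardinality at most $\kappa$, and $\kappa$-Polish if it is completely metrizable and $\kappa$-separable. If $Y$ is a Polish space (separable, completely metrizable), a set $A\subseteq Y$ is $\kappa$-Suslin if there is a closed set $D\subseteq Y\times\kappa^{\mathbb{N}}$ (with $\kappa$ discrete and $\kappa^{\mathbb{N}}$ the product topology) whose projection to $Y$ is $A$. A set $A\subseteq Y$ has the property of Baire if there is an open $O\subseteq Y$ with $(A\cup O)\setminus(A\cap O)$ meager. $BP(\kappa)$ is the statement that every $\kappa$-Suslin subset of every Polish space has the property of Baire. *)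

theory Defs
  imports "HOL-Analysis.Analysis" "HOL-Algebra.Free_Abelian_Groups" "HOL-Library.Equipollence"
begin

section \<open>Singular homology (absolute), following HOL-Homology/Simplices and Homology_Groups\<close>

type_synonym 'a chain = "((nat \<Rightarrow> real) \<Rightarrow> 'a) \<Rightarrow>\<^sub>0 int"

definition standard_simplex :: "nat \<Rightarrow> (nat \<Rightarrow> real) set" where
  "standard_simplex p \<equiv>
    {x. (\<forall>i. 0 \<le> x i \<and> x i \<le> 1) \<and> (\<forall>i>p. x i = 0) \<and> (\<Sum>i\<le>p. x i) = 1}"

definition simplical_face :: "nat \<Rightarrow> (nat \<Rightarrow> 'a) \<Rightarrow> nat \<Rightarrow> 'a::comm_monoid_add" where
   "simplical_face k x \<equiv> \<lambda>i. if i < k then x i else if i = k then 0 else x(i -1)"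

definition singular_simplex :: "nat \<Rightarrow> 'a topology \<Rightarrow> ((nat \<Rightarrow> real) \<Rightarrow> 'a) \<Rightarrow> bool" where
 "singular_simplex p X f \<equiv>
      continuous_map(subtopology (powertop_real UNIV) (standard_simplex p)) X f
    \<and> f \<in> extensional (standard_simplex p)"

definition singular_face :: "nat \<Rightarrow> nat \<Rightarrow> ((nat \<Rightarrow> real) \<Rightarrow> 'a) \<Rightarrow> (nat \<Rightarrow> real) \<Rightarrow> 'a"
  where "singular_face p k f \<equiv> restrict (f \<circ> simplical_face k) (standard_simplex (p - Suc 0))"

definition singular_chain :: "[nat, 'a topology, 'a chain] \<Rightarrow> bool"
  where "singular_chain p X c \<equiv> Poly_Mapping.keys c \<subseteq> Collect (singular_simplex p X)"

definition chain_boundary :: "nat \<Rightarrow> ('a chain) \<Rightarrow> 'a chain"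
  where "chain_boundary p c \<equiv>
          (if p = 0 then 0 else
           frag_extend (\<lambda>f. (\<Sum>k\<le>p. frag_cmul ((-1) ^ k) (frag_of(singular_face p k f)))) c)"

text \<open>Absolute cycles and boundaries (the relative notions of HOL-Homology with S = {}).\<close>

definition singular_cycle :: "nat \<Rightarrow> 'a topology \<Rightarrow> 'a chain \<Rightarrow> bool"
  where "singular_cycle p X c \<equiv> singular_chain p X c \<and> chain_boundary p c = 0"

definition singular_boundary :: "nat \<Rightarrow> 'a topology \<Rightarrow> 'a chain \<Rightarrow> bool"
  where "singular_boundary p X c \<equiv>
           \<exists>d. singular_chain (Suc p) X d \<and> chain_boundary (Suc p) d = c"

definition chain_group :: "nat \<Rightarrow> 'a topology \<Rightarrow> 'a chain monoid"
  where "chain_group p X \<equiv> free_Abelian_group (Collect (singular_simplex p X))"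

definition cycle_group :: "nat \<Rightarrow> 'a topology \<Rightarrow> 'a chain monoid"
  where "cycle_group p X \<equiv> subgroup_generated (chain_group p X) (Collect (singular_cycle p X))"

definition homology_group :: "nat \<Rightarrow> 'a topology \<Rightarrow> 'a chain set monoid"
  where "homology_group p X \<equiv> cycle_group p X Mod Collect (singular_boundary p X)"

definition kappa_separable :: "'k set \<Rightarrow> 'a topology \<Rightarrow> bool"
  where "kappa_separable K X \<equiv>
           \<exists>D. D \<subseteq> topspace X \<and> X closure_of D = topspace X \<and> D \<lesssim> K"

definition kappa_polish :: "'k set \<Rightarrow> 'a topology \<Rightarrow> bool"
  where "kappa_polish K X \<equiv> completely_metrizable_space X \<and> kappa_separable K X"

definition polish_space :: "'a topology \<Rightarrow> bool"
  where "polish_space Y \<equiv> completely_metrizable_space Y \<and> separable_space Y"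

definition kappa_suslin :: "'k set \<Rightarrow> 'a topology \<Rightarrow> 'a set \<Rightarrow> bool"
  where "kappa_suslin K Y A \<equiv>
           \<exists>D. closedin (prod_topology Y (product_topology (\<lambda>_::nat. discrete_topology K) UNIV)) D
               \<and> fst ` D = A"

definition nowhere_dense_in :: "'a topology \<Rightarrow> 'a set \<Rightarrow> bool"
  where "nowhere_dense_in Y S \<equiv> S \<subseteq> topspace Y \<and> Y interior_of (Y closure_of S) = {}"

definition meager_in :: "'a topology \<Rightarrow> 'a set \<Rightarrow> bool"
  where "meager_in Y S \<equiv>
           \<exists>F. countable F \<and> (\<forall>T\<in>F. nowhere_dense_in Y T) \<and> S \<subseteq> \<Union>F"

definition baire_property :: "'a topology \<Rightarrow> 'a set \<Rightarrow> bool"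
  where "baire_property Y A \<equiv> \<exists>U. openin Y U \<and> meager_in Y ((A \<union> U) - (A \<inter> U))"

text \<open>BP(kappa): every kappa-Suslin subset of every Polish space has the property of Baire.
  Every Polish space has cardinality at most the continuum, hence is homeomorphic to a
  Polish topology on a subset of the reals; so quantifying over Polish topologies of type
  real topology covers all Polish spaces up to homeomorphism.\<close>
definition BP :: "'k set \<Rightarrow> bool"
  where "BP K \<equiv> \<forall>Y :: real topology. polish_space Y \<longrightarrow>
                   (\<forall>A. kappa_suslin K Y A \<longrightarrow> baire_property Y A)"

end

theory Submission
  imports Defs
begin

text \<open>If every point has a neighbourhood all of whose loops are null-homologous, then every class
  is represented by a finite integral combination of at most \<open>\<kappa>\<close> arcs, chosen between points of a
  dense set inside such neighbourhoods. Otherwise some point \<open>x\<close> carries arbitrarily small essential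
  loops \<open>l\<^sub>n\<close>. For a subset \<open>\<alpha>\<close> of \<open>\<nat>\<close> let \<open>L\<^sub>\<alpha>\<close> run through those \<open>l\<^sub>n\<close> with \<open>n \<in> \<alpha>\<close>. Whether \<open>L\<^sub>\<alpha>\<close>
  and \<open>L\<^sub>\<beta>\<close> are homologous is a \<open>\<kappa>\<close>-Suslin relation, because the 2-simplices of \<open>X\<close> form a continuous
  image of \<open>\<kappa>\<^sup>\<nat>\<close> and an identity between formal sums of faces amounts to equalities between finitely
  many of them, following one of countably many patterns. Hence it has the Baire property. Changing
  the membership of one number in \<open>\<alpha>\<close> changes the class of \<open>L\<^sub>\<alpha>\<close>, so the relation is meager, and
  continuum many \<open>\<alpha>\<close> are pairwise inequivalent.\<close>

section \<open>Meager sets of sequences\<close>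

text \<open>\<open>BP K\<close> speaks of Polish spaces, whereas \<open>X\<close> need not be
  separable, and neither need its path space. The relation is therefore parametrised by a Cantor
  space, the sequences of pairs of booleans, and \<open>X\<close> enters only through equations
  imposed on unknown 2-simplices. The unknowns are absorbed by the Suslin projection: maps from a
  compact second countable space to \<open>X\<close> again form a \<open>K\<close>-Polish space,
  hence a continuous image of the \<open>K\<close>-sequences. Homology makes a single flipped
  membership visible: cutting both concatenations at the ends of the slot of \<open>l n\<close>
  splits their classes additively, the outer pieces agree, and the difference is the class of
  \<open>l n\<close>. In the case of null-homologous small loops the obstacle is that a path cut
  into short arcs has end points outside the dense set, and that neighbouring arcs lie in different
  neighbourhoods. The upper bound by the continuum is a separate count, already valid for the group
  of all 1-chains.\<close>

abbreviation seq_topology :: "'k set \<Rightarrow> (nat \<Rightarrow> 'k) topology"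
  where "seq_topology A \<equiv> product_topology (\<lambda>_::nat. discrete_topology A) UNIV"

lemma topspace_seq_topology: "topspace (seq_topology A) = {x. range x \<subseteq> A}"
  unfolding topspace_product_topology o_def topspace_discrete_topology by (auto simp: PiE_iff)

text \<open>A basic box restricts finitely many coordinates, so it contains the cylinder over a
  finite prefix of each of its points. Prefixes, unlike boxes, can be extended step by step, which
  is how the avoiding blocks are built.\<close>

lemma openin_seq_topology:
  "openin (seq_topology A) S \<longleftrightarrow>
     S \<subseteq> {x. range x \<subseteq> A} \<and>
     (\<forall>x\<in>S. \<exists>n. \<forall>y. range y \<subseteq> A \<longrightarrow> (\<forall>i<n. y i = x i) \<longrightarrow> y \<in> S)"
proof (intro iffI conjI ballI)
  assume S: "openin (seq_topology A) S"
  show "S \<subseteq> {x. range x \<subseteq> A}"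
    using openin_subset[OF S] unfolding topspace_seq_topology .
  fix x assume "x \<in> S"
  with S have "\<exists>U. finite {i \<in> UNIV. U i \<noteq> topspace (discrete_topology A)} \<and>
      (\<forall>i\<in>UNIV. openin (discrete_topology A) (U i)) \<and> x \<in> Pi\<^sub>E UNIV U \<and> Pi\<^sub>E UNIV U \<subseteq> S"
    unfolding openin_product_topology_alt by (rule bspec)
  then obtain U where U: "finite {i \<in> UNIV. U i \<noteq> topspace (discrete_topology A)}"
      "x \<in> Pi\<^sub>E UNIV U" "Pi\<^sub>E UNIV U \<subseteq> S"
    by (elim exE conjE)
  obtain n where n: "\<And>i. U i \<noteq> A \<Longrightarrow> i < n"
    using U(1) by (auto simp: finite_nat_set_iff_bounded)
  have "y \<in> S" if "range y \<subseteq> A" "\<forall>i<n. y i = x i" for y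
  proof -
    have "y i \<in> U i" for i
      using that n[of i] U(2) by (cases "i < n") (auto simp: PiE_iff)
    then show ?thesis using U(3) by auto
  qed
  then show "\<exists>n. \<forall>y. range y \<subseteq> A \<longrightarrow> (\<forall>i<n. y i = x i) \<longrightarrow> y \<in> S" by blast
next
  assume R: "S \<subseteq> {x. range x \<subseteq> A} \<and>
     (\<forall>x\<in>S. \<exists>n. \<forall>y. range y \<subseteq> A \<longrightarrow> (\<forall>i<n. y i = x i) \<longrightarrow> y \<in> S)"
  show "openin (seq_topology A) S"
    unfolding openin_product_topology_alt
  proof (intro ballI)
    fix x assume x: "x \<in> S"
    then obtain n where n: "\<And>y. range y \<subseteq> A \<Longrightarrow> (\<forall>i<n. y i = x i) \<Longrightarrow> y \<in> S"
      using R by blast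
    let ?U = "\<lambda>i. if i < n then {x i} else A"
    have "finite {i \<in> UNIV. ?U i \<noteq> topspace (discrete_topology A)}"
      by (rule finite_subset[of _ "{..<n}"]) auto
    moreover have "\<forall>i\<in>UNIV. openin (discrete_topology A) (?U i)"
      using R x by auto
    moreover have "range x \<subseteq> A" using R x by blast
    then have "x \<in> Pi\<^sub>E UNIV ?U" by (auto simp: PiE_iff)
    moreover have "Pi\<^sub>E UNIV ?U \<subseteq> S"
    proof
      fix y assume "y \<in> Pi\<^sub>E UNIV ?U"
      then have y: "y i \<in> ?U i" for i by (auto simp: PiE_iff)
      have "\<And>i. y i \<in> A" using y R x by (metis (no_types, lifting) mem_Collect_eq range_subsetD singletonD subsetD)
      moreover have "\<forall>i<n. y i = x i" using y by (metis singletonD)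
      ultimately show "y \<in> S" using n by blast
    qed
    ultimately show "\<exists>U. finite {i \<in> UNIV. U i \<noteq> topspace (discrete_topology A)} \<and>
        (\<forall>i\<in>UNIV. openin (discrete_topology A) (U i)) \<and> x \<in> Pi\<^sub>E UNIV U \<and> Pi\<^sub>E UNIV U \<subseteq> S"
      by (intro exI[of _ ?U] conjI)
  qed
qed

lemma openin_seq_topology_UNIV_cylinder:
  assumes "openin (seq_topology UNIV) S" "x \<in> S"
  obtains n where "\<And>y. (\<And>i. i < n \<Longrightarrow> y i = x i) \<Longrightarrow> y \<in> S"
  using assms unfolding openin_seq_topology by (metis top_greatest)

text \<open>Finite extension: the cylinder over the prefix of \<open>s\<close> cannot lie inside the
  closure of \<open>T\<close>, and the complement of that closure is open, so some longer prefix
  misses \<open>T\<close> altogether. Prefixes are carried by total sequences of which only the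
  first entries count.\<close>

lemma nowhere_dense_in_seq_topology_avoid:
  fixes T :: "(nat \<Rightarrow> 'b) set"
  assumes "nowhere_dense_in (seq_topology UNIV) T"
  shows "\<exists>s' n'. n \<le> n' \<and> (\<forall>i<n. s' i = s i) \<and> (\<forall>x. (\<forall>i<n'. x i = s' i) \<longrightarrow> x \<notin> T)"
proof -
  let ?C = "seq_topology (UNIV::'b set)"
  let ?N = "{x. \<forall>i<n. x i = s i}"
  have "openin ?C ?N" unfolding openin_seq_topology by (auto intro!: exI[of _ n])
  moreover have "s \<in> ?N" by auto
  moreover have "?C interior_of (?C closure_of T) = {}"
    using assms by (simp add: nowhere_dense_in_def)
  ultimately have "\<not> ?N \<subseteq> ?C closure_of T"
    using interior_of_maximal[of ?N "?C closure_of T" ?C] by (metis (lifting) empty_iff subsetD)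
  then obtain s' where s': "s' \<in> ?N" "s' \<notin> ?C closure_of T" by (meson subsetI)
  have "openin ?C (- (?C closure_of T))"
    using openin_diff[OF openin_topspace closedin_closure_of, of ?C T]
    by (simp add: Compl_eq_Diff_UNIV)
  then obtain m where m: "\<And>y. (\<And>i. i < m \<Longrightarrow> y i = s' i) \<Longrightarrow> y \<in> - (?C closure_of T)"
    using s'(2) by (elim openin_seq_topology_UNIV_cylinder) auto
  have "T \<subseteq> ?C closure_of T" by (simp add: closure_of_subset)
  have "x \<notin> T" if "\<forall>i<max m n. x i = s' i" for x
    using m[of x] that \<open>T \<subseteq> ?C closure_of T\<close> by auto
  then show ?thesis using s'(1) by (intro exI[of _ s'] exI[of _ "max m n"]) auto
qed

text \<open>The block must work after every listed prefix at once. The pairs are treated in turn: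
  each one extends the block found so far, and an extension does not harm the pairs already
  treated.\<close>

lemma block_avoiding_finitely_many:
  fixes Q :: "((nat \<Rightarrow> 'b) \<times> (nat \<Rightarrow> 'b) set) set"
  assumes "finite Q" "\<And>s T. (s,T) \<in> Q \<Longrightarrow> nowhere_dense_in (seq_topology UNIV) T"
  shows "\<exists>n' z. n < n' \<and> (\<forall>(s,T)\<in>Q. \<forall>x. (\<forall>i<n. x i = s i) \<longrightarrow> (\<forall>i. n \<le> i \<and> i < n' \<longrightarrow> x i = z i) \<longrightarrow> x \<notin> T)"
  using assms
proof (induction Q rule: finite_induct)
  case empty
  then show ?case by auto
next
  case (insert q Q)
  obtain s T where q: "q = (s,T)" by (cases q)
  have "\<exists>n' z. n < n' \<and> (\<forall>(s,T)\<in>Q. \<forall>x. (\<forall>i<n. x i = s i) \<longrightarrow> (\<forall>i. n \<le> i \<and> i < n' \<longrightarrow> x i = z i) \<longrightarrow> x \<notin> T)"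
    by (rule insert.IH) (use insert.prems in auto)
  then obtain n' z where n': "n < n'"
    and z': "\<forall>(s,T)\<in>Q. \<forall>x. (\<forall>i<n. x i = s i) \<longrightarrow> (\<forall>i. n \<le> i \<and> i < n' \<longrightarrow> x i = z i) \<longrightarrow> x \<notin> T"
    by (elim exE conjE)
  have z: "x \<notin> T" if "(s,T)\<in>Q" "\<forall>i<n. x i = s i" "\<forall>i. n \<le> i \<and> i < n' \<longrightarrow> x i = z i" for s T x
    using bspec[OF z' that(1)] that(2,3) by simp
  have "nowhere_dense_in (seq_topology UNIV) T" using insert.prems q by blast
  \<comment> \<open>The new prefix \<open>s\<close> is followed by the block found so far, and the
    result is prolonged until it misses \<open>T\<close>.\<close>
  then have "\<exists>s' m. n' \<le> m \<and> (\<forall>i<n'. s' i = (if i < n then s i else z i)) \<and> (\<forall>x. (\<forall>i<m. x i = s' i) \<longrightarrow> x \<notin> T)"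
    by (rule nowhere_dense_in_seq_topology_avoid)
  then
  obtain s' m where m: "n' \<le> m" "\<forall>i<n'. s' i = (if i < n then s i else z i)"
    "\<And>x. (\<forall>i<m. x i = s' i) \<Longrightarrow> x \<notin> T" by (elim exE conjE) (metis (full_types))
  have "x \<notin> T'" if "(s'',T') \<in> insert q Q" "\<forall>i<n. x i = s'' i" "\<forall>i. n \<le> i \<and> i < m \<longrightarrow> x i = s' i" for s'' T' x
  proof (cases "(s'',T') = q")
    case True
    then have "\<forall>i<m. x i = s' i"
      using that m n' q by (metis leI order_less_trans prod.inject)
    then show ?thesis using m True q by blast
  next
    case False
    have "\<forall>i. n \<le> i \<and> i < n' \<longrightarrow> x i = z i" using that m by auto
    then show ?thesis using z that False by blast
  qed
  then show ?case using n' m(1)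
    by (intro exI[of _ m] exI[of _ s']) auto
qed

text \<open>One direction of the Jalali-Naini--Talagrand characterization of meager sets.\<close>

lemma meager_in_seq_topology_blocks:
  fixes M :: "(nat \<Rightarrow> 'b::finite) set"
  assumes "meager_in (seq_topology UNIV) M"
  obtains a :: "nat \<Rightarrow> nat" and \<zeta> :: "nat \<Rightarrow> nat \<Rightarrow> 'b"
  where "strict_mono a" "a 0 = 0"
    "\<And>x. (\<And>m. \<exists>n\<ge>m. \<forall>i. a n \<le> i \<and> i < a (Suc n) \<longrightarrow> x i = \<zeta> n i) \<Longrightarrow> x \<notin> M"
proof -
  obtain F where F: "countable F" "\<And>T. T\<in>F \<Longrightarrow> nowhere_dense_in (seq_topology UNIV) T" "M \<subseteq> \<Union>F"
    using assms unfolding meager_in_def by blast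
  \<comment> \<open>An empty family is listed as a sequence of empty sets.\<close>
  have "\<exists>T. \<forall>j::nat. nowhere_dense_in (seq_topology (UNIV::'b set)) (T j) \<and> F \<subseteq> range T"
  proof (cases "F = {}")
    case True
    then show ?thesis by (intro exI[of _ "\<lambda>_. {}"]) (auto simp: nowhere_dense_in_def)
  next
    case False
    then show ?thesis using F by (metis equalityE from_nat_into range_from_nat_into)
  qed
  then obtain T :: "nat \<Rightarrow> (nat \<Rightarrow> 'b) set"
    where T: "\<And>j. nowhere_dense_in (seq_topology UNIV) (T j)" "M \<subseteq> (\<Union>j. T j)"
    using F by (meson Union_mono order_trans)
  \<comment> \<open>One block serves all prefixes of length \<open>n\<close>, because a finite
    alphabet leaves only finitely many of them, and it serves the first \<open>k + 1\<close> nowhere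
    dense sets together.\<close>
  have "\<exists>n' z. n < n' \<and> (\<forall>j\<le>k. \<forall>x. (\<forall>i. n \<le> i \<and> i < n' \<longrightarrow> x i = z i) \<longrightarrow> x \<notin> T j)" for n k
  proof -
    let ?Q = "(Pi\<^sub>E {..<n} (\<lambda>_. UNIV :: 'b set)) \<times> (T ` {..k})"
    have "finite ?Q" by (intro finite_cartesian_product finite_PiE finite_imageI) auto
    then have "\<exists>n' z. n < n' \<and> (\<forall>(s,S)\<in>?Q. \<forall>x. (\<forall>i<n. x i = s i) \<longrightarrow> (\<forall>i. n \<le> i \<and> i < n' \<longrightarrow> x i = z i) \<longrightarrow> x \<notin> S)"
      by (rule block_avoiding_finitely_many) (use T(1) in auto)
    then obtain n' z where n': "n < n'"
     and z: "\<forall>(s,S)\<in>?Q. \<forall>x. (\<forall>i<n. x i = s i) \<longrightarrow> (\<forall>i. n \<le> i \<and> i < n' \<longrightarrow> x i = z i) \<longrightarrow> x \<notin> S"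
      by (elim exE conjE)
    have "x \<notin> T j" if "j \<le> k" "\<forall>i. n \<le> i \<and> i < n' \<longrightarrow> x i = z i" for j x
    proof -
      have "(restrict x {..<n}, T j) \<in> ?Q" using that(1) by auto
      from bspec[OF z this] show ?thesis using that(2) by simp
    qed
    then show ?thesis using n' by blast
  qed
  then obtain nx zz where nx: "\<And>n k. n < nx n k"
    and zz: "\<And>n k j x. j \<le> k \<Longrightarrow> (\<And>i. n \<le> i \<Longrightarrow> i < nx n k \<Longrightarrow> x i = zz n k i) \<Longrightarrow> x \<notin> T j"
    by metis
  define a where "a = rec_nat 0 (\<lambda>k n. nx n k)"
  have a0: "a 0 = 0" and aS: "a (Suc k) = nx (a k) k" for k by (auto simp: a_def)
  show thesis
  proof
    show "strict_mono a" by (rule strict_monoI_Suc) (simp add: aS nx)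
    show "a 0 = 0" by (rule a0)
    fix x assume inf: "\<And>m. \<exists>n\<ge>m. \<forall>i. a n \<le> i \<and> i < a (Suc n) \<longrightarrow> x i = zz (a n) n i"
    have "x \<notin> T j" for j
    proof -
      \<comment> \<open>A single matching block of index at least \<open>j\<close> already excludes
        \<open>T j\<close>.\<close>
      obtain n where "j \<le> n" "\<forall>i. a n \<le> i \<and> i < a (Suc n) \<longrightarrow> x i = zz (a n) n i"
        using inf by blast
      then show ?thesis using zz[of j n "a n" x] by (simp add: aS)
    qed
    then show "x \<notin> M" using T(2) by blast
  qed
qed

lemma strict_mono_block:
  fixes a :: "nat \<Rightarrow> nat"
  assumes "strict_mono a" "a 0 = 0"
  obtains blk where "\<And>n i. a n \<le> i \<Longrightarrow> i < a (Suc n) \<Longrightarrow> blk i = n"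
proof
  fix n i assume i: "a n \<le> i" "i < a (Suc n)"
  show "(LEAST n. i < a (Suc n)) = n"
  proof (rule Least_equality)
    show "i < a (Suc n)" by (rule i(2))
    fix m assume "i < a (Suc m)"
    then have "a n < a (Suc m)" using i by linarith
    then show "n \<le> m" using assms(1) by (simp add: strict_mono_less)
  qed
qed

text \<open>If the open set witnessing the Baire property met the relation, flipping one coordinate far
  out would move a generic point of it to another point of it. So the relation is meager, and a
  perfect set of inequivalent points is read off the blocks that avoid it.\<close>

lemma baire_equivalence_continuum_classes:
  fixes R :: "(nat \<Rightarrow> bool) \<Rightarrow> (nat \<Rightarrow> bool) \<Rightarrow> bool"
  assumes sym: "\<And>\<alpha> \<beta>. R \<alpha> \<beta> \<Longrightarrow> R \<beta> \<alpha>"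
    and trans: "\<And>\<alpha> \<beta> \<gamma>. R \<alpha> \<beta> \<Longrightarrow> R \<beta> \<gamma> \<Longrightarrow> R \<alpha> \<gamma>"
    and flip: "\<And>\<alpha> n. \<not> R \<alpha> (\<alpha>(n := \<not> \<alpha> n))"
    and bp: "baire_property (seq_topology UNIV) {x. R (fst \<circ> x) (snd \<circ> x)}"
  obtains u :: "(nat \<Rightarrow> bool) \<Rightarrow> nat \<Rightarrow> bool" where "\<And>\<alpha> \<beta>. \<alpha> \<noteq> \<beta> \<Longrightarrow> \<not> R (u \<alpha>) (u \<beta>)"
proof -
  let ?E = "{x. R (fst \<circ> x) (snd \<circ> x)}"
  obtain U where U: "openin (seq_topology UNIV) U"
    and mea: "meager_in (seq_topology UNIV) (?E \<union> U - ?E \<inter> U)"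
    using bp unfolding baire_property_def by blast
  obtain a :: "nat \<Rightarrow> nat" and \<zeta> where a: "strict_mono a" "a 0 = 0"
    and avoid: "\<And>x. (\<And>m. \<exists>n\<ge>m. \<forall>i. a n \<le> i \<and> i < a (Suc n) \<longrightarrow> x i = \<zeta> n i) \<Longrightarrow>
       x \<notin> ?E \<union> U - ?E \<inter> U"
    using meager_in_seq_topology_blocks[OF mea] by blast
  obtain blk where blk: "\<And>n i. a n \<le> i \<Longrightarrow> i < a (Suc n) \<Longrightarrow> blk i = n"
    using strict_mono_block[OF a] by blast
  have "U = {}"
  proof (rule ccontr)
    assume "U \<noteq> {}"
    then obtain s where "s \<in> U" by blast
    then obtain p where p: "\<And>y. (\<And>i. i < p \<Longrightarrow> y i = s i) \<Longrightarrow> y \<in> U"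
      using openin_seq_topology_UNIV_cylinder[OF U] by metis
    \<comment> \<open>Both points begin inside the cylinder contained in \<open>U\<close> and follow
      the avoiding blocks later on; they differ only in the first component at
      \<open>p\<close>.\<close>
    define x where "x i = (if i < p then s i else \<zeta> (blk i) i)" for i
    define y where "y = x(p := (\<not> fst (x p), snd (x p)))"
    \<comment> \<open>The entry at \<open>p\<close> is left free, so the claim covers
      \<open>x\<close> and \<open>y\<close> alike. Blocks of index above \<open>p\<close> begin
      beyond \<open>p\<close>, since a strictly increasing \<open>a\<close> satisfies
      \<open>n \<le> a n\<close>.\<close>
    have gen: "w \<in> ?E" if w: "\<forall>i<p. w i = s i" "\<forall>i>p. w i = \<zeta> (blk i) i" for w
    proof -
      have "\<exists>n\<ge>m. \<forall>i. a n \<le> i \<and> i < a (Suc n) \<longrightarrow> w i = \<zeta> n i" for m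
      proof (intro exI[of _ "max m (Suc p)"] conjI allI impI)
        fix i assume i: "a (max m (Suc p)) \<le> i \<and> i < a (Suc (max m (Suc p)))"
        have "max m (Suc p) \<le> a (max m (Suc p))" by (rule strict_mono_imp_increasing[OF a(1)])
        then have "p < i" using i by linarith
        then show "w i = \<zeta> (max m (Suc p)) i" using w i blk by metis
      qed simp
      then have "w \<notin> ?E \<union> U - ?E \<inter> U" by (rule avoid)
      moreover have "w \<in> U" using w p by blast
      ultimately show ?thesis by blast
    qed
    have "x \<in> ?E" by (rule gen) (auto simp: x_def)
    moreover have "y \<in> ?E" by (rule gen) (auto simp: x_def y_def)
    moreover have "snd \<circ> y = snd \<circ> x" by (simp add: y_def fun_eq_iff)
    ultimately have "R (fst \<circ> x) (snd \<circ> x)" "R (fst \<circ> y) (snd \<circ> x)" by simp_all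
    then have "R (fst \<circ> x) (fst \<circ> y)" by (rule trans[OF _ sym])
    moreover have "fst \<circ> y = (fst \<circ> x)(p := \<not> (fst \<circ> x) p)" by (simp add: y_def fun_eq_iff)
    ultimately show False using flip by metis
  qed
  \<comment> \<open>Each \<open>k\<close> owns infinitely many blocks, those whose index decodes to
    a pair with first component \<open>k\<close>. There \<open>u \<alpha>\<close> copies the first
    or the second component of the pattern according to \<open>\<alpha> k\<close>. If
    \<open>\<alpha>\<close> and \<open>\<beta>\<close> differ at \<open>k\<close>, the pair of their
    images, in one of the two orders, matches the whole pattern on all these blocks.\<close>
  define u where "u \<alpha> i = (if \<alpha> (fst (prod_decode (blk i))) then fst (\<zeta> (blk i) i) else snd (\<zeta> (blk i) i))"
    for \<alpha> :: "nat \<Rightarrow> bool" and i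
  have key: "\<not> R (u \<alpha>) (u \<beta>)" if k: "\<alpha> k" "\<not> \<beta> k" for \<alpha> \<beta> k
  proof -
    let ?x = "\<lambda>i. (u \<alpha> i, u \<beta> i)"
    have "\<exists>n\<ge>m. \<forall>i. a n \<le> i \<and> i < a (Suc n) \<longrightarrow> ?x i = \<zeta> n i" for m
      using k by (intro exI[of _ "prod_encode (k,m)"]) (auto simp: u_def blk le_prod_encode_2)
    then have "?x \<notin> ?E" using avoid[of ?x] \<open>U = {}\<close> by blast
    then show ?thesis by (simp add: comp_def)
  qed
  show thesis
  proof
    fix \<alpha> \<beta> :: "nat \<Rightarrow> bool" assume "\<alpha> \<noteq> \<beta>"
    then obtain k where "\<alpha> k \<noteq> \<beta> k" by blast
    then show "\<not> R (u \<alpha>) (u \<beta>)" using key[of \<alpha> k \<beta>] key[of \<beta> k \<alpha>] sym[of "u \<alpha>" "u \<beta>"] by auto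
  qed
qed

section \<open>Images of the sequence space\<close>

lemma countable_lepoll_infinite:
  assumes "countable A" "infinite K"
  shows "A \<lesssim> K"
proof -
  have "A \<lesssim> (UNIV::nat set)"
    using assms(1) unfolding countable_def lepoll_def by auto
  then show ?thesis
    using assms(2) infinite_le_lepoll lepoll_trans by blast
qed

lemma times_lepoll_infinite:
  assumes "infinite K" "A \<lesssim> K" "B \<lesssim> K"
  shows "A \<times> B \<lesssim> K"
proof -
  have "K \<times> K \<approx> K"
    using assms(1) unfolding eqpoll_iff_card_of_ordIso by (rule card_of_Times_same_infinite)
  then show ?thesis
    using times_lepoll_mono[OF assms(2,3)] lepoll_trans2 by blast
qed

lemma Fpow_lepoll_infinite:
  assumes "infinite K" "A \<lesssim> K"
  shows "Fpow A \<lesssim> K"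
proof -
  obtain f where f: "inj_on f A" "f ` A \<subseteq> K"
    using assms(2) unfolding lepoll_def by blast
  have "Fpow A \<lesssim> Fpow K"
    unfolding lepoll_def using inj_on_image_Fpow[OF f(1)] image_Fpow_mono[OF f(2)] by blast
  then show ?thesis
    using eqpoll_Fpow[OF assms(1)] lepoll_trans2 by blast
qed

lemma lepoll_surjection:
  assumes "A \<lesssim> K" "A \<noteq> {}"
  obtains r where "r ` K \<subseteq> A" "A \<subseteq> r ` K"
proof -
  obtain g where g: "A \<subseteq> g ` K" using assms(1) unfolding lepoll_iff by blast
  obtain a where a: "a \<in> A" using assms(2) by blast
  show thesis
    by (rule that[of "\<lambda>k. if g k \<in> A then g k else a"]) (use g a in auto)
qed

section \<open>Continuous parametrisation of \<open>K\<close>-Polish spaces by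
  \<open>K\<close>-sequences\<close>

text \<open>Every sequence of indices is made to converge by refusing long jumps: \<open>y c\<close>
  moves on to the next named dense point only if that is closer than \<open>(1/2)^n\<close>, and
  otherwise stays. So the limit \<open>s c\<close> exists for all \<open>c\<close>, and its first
  \<open>n + 1\<close> indices fix it up to an error of \<open>2 * (1/2)^n\<close> around
  \<open>y c n\<close>, which gives continuity.\<close>

lemma kappa_polish_seq_surjection:
  fixes K :: "'k set" and X :: "'a topology"
  assumes "kappa_polish K X" "topspace X \<noteq> {}"
  obtains s where "continuous_map (seq_topology K) X s"
    "\<And>x. x \<in> topspace X \<Longrightarrow> \<exists>c. range c \<subseteq> K \<and> s c = x"
proof -
  obtain M d where md: "Metric_space M d" "Metric_space.mcomplete M d"
    and X: "X = Metric_space.mtopology M d"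
    using assms(1) unfolding kappa_polish_def completely_metrizable_space_def by blast
  interpret Metric_space M d by (rule md(1))
  obtain D where D: "D \<subseteq> M" "mtopology closure_of D = M" "D \<lesssim> K"
    using assms(1) unfolding kappa_polish_def kappa_separable_def X by auto
  have "D \<noteq> {}" using D(2) assms(2) X by auto
  then obtain r where r: "r ` K \<subseteq> D" "D \<subseteq> r ` K" using lepoll_surjection[OF D(3)] by blast
  define y where "y = (\<lambda>c. rec_nat (r (c 0))
      (\<lambda>n v. if d v (r (c (Suc n))) < (1/2)^n then r (c (Suc n)) else v))"
  have y0: "y c 0 = r (c 0)"
    and yS: "y c (Suc n) = (if d (y c n) (r (c (Suc n))) < (1/2)^n then r (c (Suc n)) else y c n)" for c n
    by (simp_all add: y_def)
  have rM: "r k \<in> M" if "k \<in> K" for k using r(1) D(1) that by blast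
  have yM: "y c n \<in> M" if "range c \<subseteq> K" for c n
    by (induction n) (use that rM in \<open>auto simp: y0 yS\<close>)
  have ystep: "d (y c n) (y c (Suc n)) \<le> (1/2)^n" if "range c \<subseteq> K" for c n
    using yM[OF that, of n] by (auto simp: yS)
  have ydep: "y c n = y c' n" if "\<And>i. i \<le> n \<Longrightarrow> c i = c' i" for c c' n
    using that by (induction n) (auto simp: y0 yS)
  \<comment> \<open>The subtracted term carries the induction on \<open>m\<close>: a step of length
    at most \<open>(1/2)^m\<close> uses up half of it.\<close>
  have ytail: "d (y c n) (y c m) \<le> 2*(1/2)^n - 2*(1/2)^m" if c: "range c \<subseteq> K" and "n \<le> m" for c n m
    using \<open>n \<le> m\<close>
  proof (induction m rule: dec_induct)
    case base
    then show ?case using yM[OF c] by simp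
  next
    case (step m)
    have "d (y c n) (y c (Suc m)) \<le> d (y c n) (y c m) + d (y c m) (y c (Suc m))"
      using yM[OF c] by (intro triangle) auto
    then show ?case using step.IH ystep[OF c, of m] by simp
  qed
  have cauchy: "MCauchy (y c)" if c: "range c \<subseteq> K" for c
    unfolding MCauchy_def
  proof (intro conjI allI impI)
    show "range (y c) \<subseteq> M" using yM[OF c] by blast
    fix e :: real assume "e > 0"
    then obtain N where N: "(1/2)^N < e/4"
      using real_arch_pow_inv[of "e/4" "1/2"] by auto
    have "d (y c n) (y c n') < e" if n: "N \<le> n" "N \<le> n'" for n n'
    proof -
      have "d (y c n) (y c n') \<le> d (y c N) (y c n) + d (y c N) (y c n')"
        using yM[OF c] by (intro triangle'') auto
      moreover have "d (y c N) (y c n) \<le> 2*(1/2)^N" "d (y c N) (y c n') \<le> 2*(1/2)^N"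
        using ytail[OF c n(1)] ytail[OF c n(2)] by (smt (verit) zero_le_power divide_nonneg_nonneg)+
      ultimately show ?thesis using N by linarith
    qed
    then show "\<exists>N. \<forall>n n'. N \<le> n \<longrightarrow> N \<le> n' \<longrightarrow> d (y c n) (y c n') < e" by blast
  qed
  have "\<exists>l. range c \<subseteq> K \<longrightarrow> limitin mtopology (y c) l sequentially" for c
    using md(2) cauchy unfolding mcomplete_def by blast
  then obtain s where s: "\<And>c. range c \<subseteq> K \<Longrightarrow> limitin mtopology (y c) (s c) sequentially"
    by metis
  have sM: "s c \<in> M" if "range c \<subseteq> K" for c
    using s[OF that] limitin_mspace by blast
  have slim: "d (y c n) (s c) \<le> 2*(1/2)^n" if c: "range c \<subseteq> K" for c n
  proof (rule field_le_epsilon)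
    fix e :: real assume "e > 0"
    then obtain N where N: "\<And>m. m \<ge> N \<Longrightarrow> d (y c m) (s c) < e"
      using s[OF c] unfolding limit_metric_sequentially by blast
    have "d (y c n) (s c) \<le> d (y c n) (y c (max n N)) + d (y c (max n N)) (s c)"
      using yM[OF c] sM[OF c] by (intro triangle) auto
    moreover have "d (y c n) (y c (max n N)) \<le> 2*(1/2)^n"
      using ytail[OF c, of n "max n N"] by (smt (verit) max.cobounded1 zero_le_power divide_nonneg_nonneg)
    ultimately show "d (y c n) (s c) \<le> 2*(1/2)^n + e"
      using N[of "max n N"] by auto
  qed
  show thesis
  proof
    show "continuous_map (seq_topology K) X s"
      unfolding X continuous_map_to_metric
    proof (intro ballI allI impI)
      fix c and e :: real
      assume "c \<in> topspace (seq_topology K)" and e: "0 < e"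
      then have c: "range c \<subseteq> K" unfolding topspace_seq_topology by simp
      obtain N where N: "(1/2)^N < e/4"
        using real_arch_pow_inv[of "e/4" "1/2"] e by auto
      let ?U = "{c'. range c' \<subseteq> K \<and> (\<forall>i<Suc N. c' i = c i)}"
      have "openin (seq_topology K) ?U"
        unfolding openin_seq_topology
        by (intro conjI ballI exI[of _ "Suc N"]) auto
      moreover have "c \<in> ?U" using c by simp
      moreover have "s c' \<in> mball (s c) e" if "c' \<in> ?U" for c'
      proof -
        have c': "range c' \<subseteq> K" using that by simp
        have eq: "y c' N = y c N" using that by (intro ydep) auto
        have "d (s c) (s c') \<le> d (y c N) (s c) + d (y c N) (s c')"
          using yM[OF c] sM[OF c] sM[OF c'] by (intro triangle'') auto
        also have "\<dots> \<le> 2*(1/2)^N + 2*(1/2)^N"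
          using slim[OF c, of N] slim[OF c', of N] eq by simp
        also have "\<dots> < e" using N by simp
        finally show ?thesis using sM[OF c] sM[OF c'] by simp
      qed
      ultimately show "\<exists>U. openin (seq_topology K) U \<and> c \<in> U \<and> (\<forall>y\<in>U. s y \<in> mball (s c) e)"
        by (intro exI[of _ ?U]) auto
    qed
    fix x assume "x \<in> topspace X"
    then have x: "x \<in> M" using X by simp
    \<comment> \<open>With errors below \<open>(1/2)^(n+2)\<close> consecutive approximations are
      closer than \<open>1/4 + 1/8\<close> of \<open>(1/2)^n\<close>. Hence no jump is refused and
      \<open>y c\<close> runs through all of them.\<close>
    have "\<exists>k\<in>K. d x (r k) < (1/2)^(n+2)" for n
    proof -
      have "x \<in> mtopology closure_of D" using x D(2) by simp
      then have "\<forall>r>0. \<exists>q\<in>D. q \<in> mball x r" unfolding metric_closure_of by simp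
      then have "\<exists>q\<in>D. q \<in> mball x ((1/2)^(n+2))" by (rule allE[of _ "(1/2)^(n+2)"]) simp
      then obtain q where "q \<in> D" "d x q < (1/2)^(n+2)" by auto
      then show ?thesis using r(2) by (metis imageE subsetD)
    qed
    then obtain c where cK: "\<And>n. c n \<in> K" and cx: "\<And>n. d x (r (c n)) < (1/2)^(n+2)" by metis
    have c: "range c \<subseteq> K" using cK by blast
    have yr: "y c n = r (c n)" for n
    proof (induction n)
      case 0
      then show ?case by (simp add: y0)
    next
      case (Suc n)
      have "d (r (c n)) (r (c (Suc n))) \<le> d x (r (c n)) + d x (r (c (Suc n)))"
        using rM cK x by (intro triangle'') auto
      also have "\<dots> < (1/2)^(n+2) + (1/2)^(Suc n+2)" using cx[of n] cx[of "Suc n"] by linarith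
      also have "\<dots> \<le> (1/2)^n" by (simp add: power_add)
      finally show ?case using Suc by (simp add: yS)
    qed
    have "d x (s c) = 0"
    proof (rule ccontr)
      assume "d x (s c) \<noteq> 0"
      then have "d x (s c) > 0" using nonneg[of x "s c"] by linarith
      then obtain N where N: "(1/2)^N < d x (s c) / 4"
        using real_arch_pow_inv[of "d x (s c)/4" "1/2"] by auto
      have "d x (s c) \<le> d x (r (c N)) + d (r (c N)) (s c)"
        using rM cK x sM[OF c] by (intro triangle) auto
      also have "\<dots> \<le> (1/2)^N + 2*(1/2)^N"
      proof -
        have "(1/2::real)^(N+2) \<le> (1/2)^N" by (simp add: power_add)
        then show ?thesis using cx[of N] slim[OF c, of N] unfolding yr by linarith
      qed
      moreover have "0 \<le> (1/2::real)^N" by simp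
      ultimately show False using N by linarith
    qed
    then have "s c = x" using x sM[OF c] by simp
    then show "\<exists>c. range c \<subseteq> K \<and> s c = x" using c by blast
  qed
qed

text \<open>For separability a map is described up to \<open>(1/2)^n\<close> by a finite cover with
  basic open sets, each labelled by a dense point near its image. There are at most \<open>K\<close>
  such descriptions, and two maps fitting the same one are within \<open>2 * (1/2)^n\<close>. As
  \<open>X\<close> offers no way to build a map from a description, \<open>h\<close> picks one map
  for each description that is fitted at all.\<close>

lemma kappa_polish_cfunspace:
  fixes K :: "'k set" and P :: "'p topology" and m :: "'a metric"
  assumes "infinite K" and P: "compact_space P" "second_countable P"
    and X: "mcomplete_of m" "kappa_separable K (mtopology_of m)"
  shows "kappa_polish K (mtopology_of (cfunspace P m))"
proof -
  let ?C = "mspace (cfunspace P m)" and ?\<rho> = "mdist (cfunspace P m)"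
  interpret M: Metric_space "mspace m" "mdist m" by simp
  interpret C: Metric_space ?C ?\<rho> by (rule Metric_space_mspace_mdist)
  have "M.Self = m" by (simp add: M.Self_def)
  then have "mcomplete_of (cfunspace P m)"
    using M.mcomplete_cfunspace X(1) by (metis mcomplete_of_def)
  then have compl: "completely_metrizable_space (mtopology_of (cfunspace P m))"
    unfolding completely_metrizable_space_def mcomplete_of_def mtopology_of_def
    using Metric_space_mspace_mdist by blast
  obtain D where D: "D \<subseteq> mspace m" "M.mtopology closure_of D = mspace m" "D \<lesssim> K"
    using X(2) unfolding kappa_separable_def mtopology_of_def by auto
  obtain B where B: "countable B" "\<And>V. V \<in> B \<Longrightarrow> openin P V"
    "\<And>U x. openin P U \<Longrightarrow> x \<in> U \<Longrightarrow> \<exists>V\<in>B. x \<in> V \<and> V \<subseteq> U"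
    using P(2) unfolding second_countable_def by metis
  define good where "good = (\<lambda>(n::nat, S) f. f \<in> ?C \<and> topspace P \<subseteq> \<Union>(fst ` S) \<and>
      (\<forall>(U,q)\<in>S. f ` U \<subseteq> M.mball q ((1/2)^n)))"
  define W where "W = {w \<in> (UNIV::nat set) \<times> Fpow (B \<times> D). \<exists>f. good w f}"
  define h where "h w = (SOME f. good w f)" for w
  have h: "good w (h w)" if "w \<in> W" for w
    using that unfolding W_def h_def by (metis (mono_tags, lifting) mem_Collect_eq someI_ex)
  have "W \<lesssim> K"
  proof -
    have "B \<times> D \<lesssim> K"
      using times_lepoll_infinite[OF assms(1) countable_lepoll_infinite[OF B(1) assms(1)] D(3)] .
    then have "Fpow (B \<times> D) \<lesssim> K" by (rule Fpow_lepoll_infinite[OF assms(1)])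
    moreover have "(UNIV::nat set) \<lesssim> K" by (rule countable_lepoll_infinite[OF _ assms(1)]) simp
    ultimately have "(UNIV::nat set) \<times> Fpow (B \<times> D) \<lesssim> K"
      by (intro times_lepoll_infinite[OF assms(1)])
    moreover have "W \<subseteq> (UNIV::nat set) \<times> Fpow (B \<times> D)" unfolding W_def by (rule Collect_restrict)
    ultimately show ?thesis using lepoll_trans[OF subset_imp_lepoll] by blast
  qed
  then have hW: "h ` W \<lesssim> K" by (rule lepoll_trans[OF image_lepoll])
  have hC: "h ` W \<subseteq> ?C" using h unfolding good_def by (auto split: prod.splits simp del: mspace_cfunspace)
  have dense: "\<exists>w\<in>W. h w \<in> C.mball g e" if g: "g \<in> ?C" and e: "e > 0" for g e
  proof -
    obtain n where n: "(1/2)^n < e/4"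
      using real_arch_pow_inv[of "e/4" "1/2"] e by auto
    have gc: "continuous_map P M.mtopology g" and gm: "\<And>p. p \<in> topspace P \<Longrightarrow> g p \<in> mspace m"
      using g by (auto simp: mtopology_of_def)
    have "\<exists>V q. V \<in> B \<and> q \<in> D \<and> p \<in> V \<and> g ` V \<subseteq> M.mball q ((1/2)^n)" if p: "p \<in> topspace P" for p
    proof -
      have "g p \<in> M.mtopology closure_of D" using D(2) gm[OF p] by simp
      then have "\<exists>q\<in>D. q \<in> M.mball (g p) ((1/2)^n)"
        unfolding M.metric_closure_of by simp
      then obtain q where q: "q \<in> D" "g p \<in> M.mball q ((1/2)^n)"
        using M.commute by auto
      have "openin P {x \<in> topspace P. g x \<in> M.mball q ((1/2)^n)}"
        by (rule openin_continuous_map_preimage[OF gc M.openin_mball])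
      then obtain V where "V \<in> B" "p \<in> V" "V \<subseteq> {x \<in> topspace P. g x \<in> M.mball q ((1/2)^n)}"
        using B(3)[of _ p] q(2) p by blast
      then show ?thesis using q(1) by blast
    qed
    then obtain V q where V: "\<And>p. p \<in> topspace P \<Longrightarrow> V p \<in> B \<and> q p \<in> D \<and> p \<in> V p \<and> g ` V p \<subseteq> M.mball (q p) ((1/2)^n)"
      by metis
    have "\<exists>F. finite F \<and> F \<subseteq> V ` topspace P \<and> topspace P \<subseteq> \<Union>F"
    proof -
      have "\<forall>U\<in>V ` topspace P. openin P U" using V B(2) by blast
      moreover have "topspace P \<subseteq> \<Union>(V ` topspace P)" using V by blast
      ultimately show ?thesis using P(1) unfolding compact_space_alt by blast
    qed
    then obtain T where T: "finite T" "T \<subseteq> topspace P" "topspace P \<subseteq> \<Union>(V ` T)"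
      by (metis finite_subset_image)
    define S where "S = (\<lambda>p. (V p, q p)) ` T"
    have gg: "good (n, S) g"
      unfolding good_def prod.case
    proof (intro conjI ballI)
      show "topspace P \<subseteq> \<Union>(fst ` S)" using T(3) by (simp add: S_def image_image)
      fix w assume "w \<in> S"
      then obtain t where "t \<in> T" "w = (V t, q t)" unfolding S_def by blast
      then show "case w of (U, q) \<Rightarrow> g ` U \<subseteq> M.mball q ((1/2)^n)"
        using V T(2) by (metis case_prod_conv subsetD)
    qed (rule g)
    moreover have "S \<in> Fpow (B \<times> D)"
      using T V unfolding S_def Fpow_def by auto
    ultimately have w: "(n, S) \<in> W" unfolding W_def by blast
    then have hg: "good (n, S) (h (n, S))" by (rule h)
    have "?\<rho> g (h (n, S)) \<le> e/2"
    proof (rule mdist_cfunspace_le)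
      fix p assume p: "p \<in> topspace P"
      then obtain t where t: "t \<in> T" "p \<in> V t" using T(3) by blast
      have "(V t, q t) \<in> S" using t unfolding S_def by blast
      then have "g p \<in> M.mball (q t) ((1/2)^n)" "h (n,S) p \<in> M.mball (q t) ((1/2)^n)"
        using gg hg t(2) unfolding good_def by blast+
      then have "mdist m (g p) (h (n,S) p) \<le> mdist m (q t) (g p) + mdist m (q t) (h (n,S) p)"
        "mdist m (q t) (g p) < (1/2)^n" "mdist m (q t) (h (n,S) p) < (1/2)^n"
        using M.triangle''[of "g p" "q t" "h (n,S) p"] by auto
      then show "mdist m (g p) (h (n,S) p) \<le> e/2" using n by linarith
    qed (use e in auto)
    then have "?\<rho> g (h (n, S)) < e" using e by linarith
    moreover have "h (n, S) \<in> ?C" using hC w by (metis image_subset_iff)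
    ultimately have "h (n, S) \<in> C.mball g e"
      unfolding C.in_mball using g by (intro conjI)
    then show ?thesis using w by blast
  qed
  have "C.mtopology closure_of (h ` W) = ?C"
    unfolding C.metric_closure_of using dense by (auto simp del: mspace_cfunspace C.in_mball)
  then have "kappa_separable K (mtopology_of (cfunspace P m))"
    unfolding kappa_separable_def using hW hC
    by (intro exI[of _ "h ` W"]) (simp add: mtopology_of_def del: mspace_cfunspace)
  with compl show ?thesis unfolding kappa_polish_def by blast
qed

text \<open>Evaluation at a point does not increase distances in the uniform metric, so the
  parametrisation of the function space is continuous pointwise as well. The equations imposed later
  only compare values at points.\<close>

lemma continuous_maps_seq_surjection:
  fixes K :: "'k set" and P :: "'p topology" and X :: "'a topology"
  assumes "infinite K" and P: "compact_space P" "second_countable P"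
    and X: "kappa_polish K X" "topspace X \<noteq> {}"
  obtains s :: "(nat \<Rightarrow> 'k) \<Rightarrow> 'p \<Rightarrow> 'a" where
    "\<And>c. range c \<subseteq> K \<Longrightarrow> continuous_map P X (s c) \<and> s c \<in> extensional (topspace P)"
    "\<And>f. continuous_map P X f \<Longrightarrow> f \<in> extensional (topspace P) \<Longrightarrow> \<exists>c. range c \<subseteq> K \<and> s c = f"
    "\<And>p. p \<in> topspace P \<Longrightarrow> continuous_map (seq_topology K) X (\<lambda>c. s c p)"
proof -
  obtain M d where md: "Metric_space M d" "Metric_space.mcomplete M d"
    and X_eq: "X = Metric_space.mtopology M d"
    using X(1) unfolding kappa_polish_def completely_metrizable_space_def by blast
  interpret Metric_space M d by (rule md(1))
  define m where "m = metric (M,d)"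
  have m: "mtopology_of m = X" "mspace m = M" "mdist m = d" by (simp_all add: m_def X_eq)
  have "mcomplete_of m" unfolding mcomplete_of_def m by (rule md(2))
  moreover have "kappa_separable K (mtopology_of m)" using X(1) unfolding kappa_polish_def m by blast
  ultimately have pol: "kappa_polish K (mtopology_of (cfunspace P m))"
    by (rule kappa_polish_cfunspace[OF assms(1) P])
  interpret C: Metric_space "mspace (cfunspace P m)" "mdist (cfunspace P m)" by (rule Metric_space_mspace_mdist)
  have Ctop: "topspace (mtopology_of (cfunspace P m)) = mspace (cfunspace P m)"
    by (simp only: mtopology_of_def C.topspace_mtopology)
  have Cspace: "f \<in> mspace (cfunspace P m) \<longleftrightarrow> continuous_map P X f \<and> f \<in> extensional (topspace P)" for f
  proof -
    have "compactin P (topspace P)" using P(1) unfolding compact_space_def .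
    from compactin_mspace_cfunspace[OF this, of m] show ?thesis
      unfolding m using continuous_map_image_subset_topspace[of P X f] X_eq by auto
  qed
  obtain a where "a \<in> topspace X" using X(2) by blast
  then have "restrict (\<lambda>_. a) (topspace P) \<in> mspace (cfunspace P m)"
    unfolding Cspace by (auto intro: continuous_map_eq[of P X "\<lambda>_. a"])
  then have "topspace (mtopology_of (cfunspace P m)) \<noteq> {}" unfolding Ctop by blast
  then obtain s where s: "continuous_map (seq_topology K) (mtopology_of (cfunspace P m)) s"
    and surj: "\<And>f. f \<in> mspace (cfunspace P m) \<Longrightarrow> \<exists>c. range c \<subseteq> K \<and> s c = f"
    using kappa_polish_seq_surjection[OF pol] unfolding Ctop by metis
  show thesis
  proof
    fix c :: "nat \<Rightarrow> 'k" assume "range c \<subseteq> K"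
    then have "c \<in> topspace (seq_topology K)" unfolding topspace_seq_topology by simp
    then have "s c \<in> mspace (cfunspace P m)"
      using continuous_map_image_subset_topspace[OF s] unfolding Ctop by blast
    then show "continuous_map P X (s c) \<and> s c \<in> extensional (topspace P)" unfolding Cspace .
  next
    fix f assume "continuous_map P X f" "f \<in> extensional (topspace P)"
    then show "\<exists>c. range c \<subseteq> K \<and> s c = f" using surj unfolding Cspace by blast
  next
    fix p assume p: "p \<in> topspace P"
    have "continuous_map (mtopology_of (cfunspace P m)) X (\<lambda>f. f p)"
      unfolding X_eq continuous_map_to_metric Ctop
    proof (intro ballI allI impI)
      fix f and e :: real assume f: "f \<in> mspace (cfunspace P m)" and e: "0 < e"
      have "g p \<in> mball (f p) e" if "g \<in> C.mball f e" for g
      proof -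
        have g: "g \<in> mspace (cfunspace P m)" "mdist (cfunspace P m) f g < e"
          using that unfolding C.in_mball by blast+
        have "mdist (cfunspace P m) f g \<le> mdist (cfunspace P m) f g" by simp
        then have "mdist m (f p) (g p) \<le> mdist (cfunspace P m) f g"
          by (rule mdist_cfunspace_imp_mdist_le[OF f g(1) _ p])
        then have "d (f p) (g p) < e" using g(2) unfolding m by linarith
        moreover have "f p \<in> M" "g p \<in> M"
          using f g(1) p continuous_map_image_subset_topspace[of P X] X_eq unfolding Cspace by fastforce+
        ultimately show ?thesis by simp
      qed
      then show "\<exists>U. openin (mtopology_of (cfunspace P m)) U \<and> f \<in> U \<and> (\<forall>y\<in>U. y p \<in> mball (f p) e)"
        unfolding mtopology_of_def using f e C.openin_mball C.centre_in_mball_iff by blast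
    qed
    from continuous_map_compose[OF s this]
    show "continuous_map (seq_topology K) X (\<lambda>c. s c p)" by (simp add: comp_def)
  qed
qed

section \<open>Suslin sets: unions and solvability of equations\<close>

lemma continuous_map_seq_reindex:
  "continuous_map (seq_topology K) (seq_topology K) (\<lambda>c i. c (r i))"
  unfolding continuous_map_componentwise_UNIV
  by (intro allI continuous_map_product_projection) simp

text \<open>The first entry selects a fibre and the remaining ones form a point of it. Since the
  entry ranges over a discrete space, the complement is a union of open pieces, one for each
  \<open>k\<close>.\<close>

lemma closedin_seq_fibres:
  assumes "\<And>k. k \<in> K \<Longrightarrow> closedin (prod_topology Y (seq_topology K)) (D k)"
  shows "closedin (prod_topology Y (seq_topology K))
     {z \<in> topspace (prod_topology Y (seq_topology K)). (fst z, \<lambda>i. snd z (Suc i)) \<in> D (snd z 0)}"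
    (is "closedin ?T ?S")
proof -
  let ?shift = "\<lambda>z. (fst z, \<lambda>i. snd z (Suc i))"
  have "continuous_map ?T (seq_topology K) ((\<lambda>c i. c (Suc i)) \<circ> snd)"
    by (rule continuous_map_compose[OF continuous_map_snd continuous_map_seq_reindex])
  then have sh: "continuous_map ?T ?T ?shift"
    by (intro continuous_map_pairedI continuous_map_fst) (simp add: comp_def)
  have "continuous_map ?T (discrete_topology K) ((\<lambda>c. c 0) \<circ> snd)"
    by (rule continuous_map_compose[OF continuous_map_snd]) (rule continuous_map_product_projection, simp)
  then have pr: "continuous_map ?T (discrete_topology K) (\<lambda>z. snd z 0)" by (simp add: comp_def)
  have hd: "snd z 0 \<in> K" if "z \<in> topspace ?T" for z
    using continuous_map_image_subset_topspace[OF pr] that by auto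
  have "openin ?T ({z \<in> topspace ?T. ?shift z \<in> topspace ?T - D k} \<inter> {z \<in> topspace ?T. snd z 0 \<in> {k}})"
    if "k \<in> K" for k
    by (intro openin_Int openin_continuous_map_preimage[OF sh] openin_continuous_map_preimage[OF pr]
        openin_diff openin_topspace assms that) (simp add: that)
  then have "openin ?T (\<Union>k\<in>K. {z \<in> topspace ?T. ?shift z \<in> topspace ?T - D k} \<inter> {z \<in> topspace ?T. snd z 0 \<in> {k}})"
    by (intro openin_Union) auto
  moreover have "(\<Union>k\<in>K. {z \<in> topspace ?T. ?shift z \<in> topspace ?T - D k} \<inter> {z \<in> topspace ?T. snd z 0 \<in> {k}})
      = topspace ?T - ?S"
  proof (intro equalityI subsetI)
    fix z assume "z \<in> topspace ?T - ?S"
    moreover from this have "?shift z \<in> topspace ?T"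
      using continuous_map_image_subset_topspace[OF sh] by blast
    ultimately show "z \<in> (\<Union>k\<in>K. {z \<in> topspace ?T. ?shift z \<in> topspace ?T - D k} \<inter> {z \<in> topspace ?T. snd z 0 \<in> {k}})"
      using hd[of z] by (intro UN_I[of "snd z 0"]) auto
  qed auto
  ultimately show ?thesis unfolding closedin_def by auto
qed

text \<open>The head of a code names, through \<open>r\<close>, a member of the family, and its tail
  is a code with respect to that member. A union of at most \<open>K\<close> sets thus costs one
  extra coordinate.\<close>

lemma kappa_suslin_UN:
  assumes "V \<lesssim> K" "\<And>v. v \<in> V \<Longrightarrow> kappa_suslin K Y (A v)"
  shows "kappa_suslin K Y (\<Union>v\<in>V. A v)"
proof (cases "V = {}")
  case True
  then show ?thesis unfolding kappa_suslin_def by (intro exI[of _ "{}"]) simp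
next
  case False
  then obtain r where r: "r ` K \<subseteq> V" "V \<subseteq> r ` K" using lepoll_surjection assms(1) by metis
  let ?T = "prod_topology Y (seq_topology K)"
  obtain D where D: "\<And>v. v \<in> V \<Longrightarrow> closedin ?T (D v) \<and> fst ` D v = A v"
    using assms(2) unfolding kappa_suslin_def by metis
  let ?S = "{z \<in> topspace ?T. (fst z, \<lambda>i. snd z (Suc i)) \<in> D (r (snd z 0))}"
  have "closedin ?T ?S"
    by (rule closedin_seq_fibres) (use D r in auto)
  moreover have "fst ` ?S = (\<Union>v\<in>V. A v)"
  proof (intro equalityI subsetI)
    fix y assume "y \<in> fst ` ?S"
    then obtain z where z: "z \<in> topspace ?T" "(fst z, \<lambda>i. snd z (Suc i)) \<in> D (r (snd z 0))" "y = fst z"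
      by blast
    have "snd z 0 \<in> K" using z(1) by (auto simp: topspace_seq_topology simp del: topspace_product_topology)
    then have "r (snd z 0) \<in> V" using r by blast
    then show "y \<in> (\<Union>v\<in>V. A v)" using z D by force
  next
    fix y assume "y \<in> (\<Union>v\<in>V. A v)"
    then obtain v where v: "v \<in> V" "y \<in> A v" by blast
    then obtain c where c: "(y, c) \<in> D v" using D by force
    then have yc: "(y, c) \<in> topspace ?T" using D[OF v(1)] closedin_subset by blast
    obtain k where k: "k \<in> K" "v = r k" using r v(1) by blast
    have "range c \<subseteq> K" "y \<in> topspace Y"
      using yc by (auto simp: topspace_seq_topology simp del: topspace_product_topology)
    then have "(y, case_nat k c) \<in> topspace ?T"
      using k(1) by (auto simp: topspace_seq_topology image_subset_iff simp del: topspace_product_topology split: nat.splits)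
    then have "(y, case_nat k c) \<in> ?S" using c k by simp
    then show "y \<in> fst ` ?S" by force
  qed
  ultimately show ?thesis unfolding kappa_suslin_def by blast
qed

text \<open>A term denotes an element of a space \<open>X\<close>: \<open>Inl h\<close> is the value of \<open>h\<close> at the
  parameter, \<open>Inr (i, p)\<close> is the value of the \<open>i\<close>-th unknown map at the point \<open>p\<close>.\<close>

fun eval_term :: "('y \<Rightarrow> 'a) + nat \<times> 'p \<Rightarrow> 'y \<Rightarrow> (nat \<Rightarrow> 'p \<Rightarrow> 'a) \<Rightarrow> 'a"
  where
    "eval_term (Inl h) y f = h y"
  | "eval_term (Inr (i, p)) y f = f i p"

text \<open>The unknown maps are the witnesses removed by the projection, countably many of them
  packed into one \<open>K\<close>-sequence by \<open>prod_encode\<close>. Both sides of an equation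
  are continuous in the parameter and the code, and \<open>X\<close> is Hausdorff, so each equation
  is a closed condition. Arbitrarily many may be imposed; the equality of two faces takes one for
  each point of the 1-simplex.\<close>

lemma kappa_suslin_solvable:
  fixes K :: "'k set" and P :: "'p topology" and X :: "'a topology"
    and E :: "((('y \<Rightarrow> 'a) + nat \<times> 'p) \<times> (('y \<Rightarrow> 'a) + nat \<times> 'p)) set"
  assumes "infinite K" and P: "compact_space P" "second_countable P"
    and X: "kappa_polish K X" "topspace X \<noteq> {}"
    and E: "E \<subseteq> (Collect (continuous_map Y X) <+> UNIV \<times> topspace P) \<times> (Collect (continuous_map Y X) <+> UNIV \<times> topspace P)"
  shows "kappa_suslin K Y {y \<in> topspace Y. \<exists>f.
     (\<forall>i. continuous_map P X (f i) \<and> f i \<in> extensional (topspace P)) \<and>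
     (\<forall>(t,u)\<in>E. eval_term t y f = eval_term u y f)}"
proof -
  obtain s :: "(nat \<Rightarrow> 'k) \<Rightarrow> 'p \<Rightarrow> 'a" where
    s: "\<And>c. range c \<subseteq> K \<Longrightarrow> continuous_map P X (s c) \<and> s c \<in> extensional (topspace P)"
    and surj: "\<And>f. continuous_map P X f \<Longrightarrow> f \<in> extensional (topspace P) \<Longrightarrow> \<exists>c. range c \<subseteq> K \<and> s c = f"
    and cont: "\<And>p. p \<in> topspace P \<Longrightarrow> continuous_map (seq_topology K) X (\<lambda>c. s c p)"
    using continuous_maps_seq_surjection[OF assms(1) P X] by blast
  let ?T = "prod_topology Y (seq_topology K)"
  define F where "F c i = s (\<lambda>k. c (prod_encode (i, k)))" for c i
  have Fcont: "continuous_map ?T X (\<lambda>z. eval_term t (fst z) (F (snd z)))"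
    if t: "t \<in> Collect (continuous_map Y X) <+> UNIV \<times> topspace P" for t
  proof (cases t)
    case (Inl h)
    then have "continuous_map Y X h" using t by auto
    from continuous_map_compose[OF continuous_map_fst this] show ?thesis
      by (simp add: Inl comp_def)
  next
    case (Inr q)
    then obtain i p where q: "t = Inr (i, p)" "p \<in> topspace P" using t by (cases q) auto
    have "continuous_map (seq_topology K) X ((\<lambda>c. s c p) \<circ> (\<lambda>c k. c (prod_encode (i, k))))"
      by (rule continuous_map_compose[OF continuous_map_seq_reindex cont[OF q(2)]])
    from continuous_map_compose[OF continuous_map_snd this] show ?thesis
      by (simp add: q comp_def F_def)
  qed
  have "Hausdorff_space X"
    using X(1) unfolding kappa_polish_def
    using completely_metrizable_imp_metrizable_space metrizable_imp_Hausdorff_space by blast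
  then have cl: "closedin ?T {z \<in> topspace ?T. eval_term (fst e) (fst z) (F (snd z)) = eval_term (snd e) (fst z) (F (snd z))}"
    if "e \<in> E" for e
  proof (rule closedin_continuous_maps_eq)
    show "continuous_map ?T X (\<lambda>z. eval_term (fst e) (fst z) (F (snd z)))"
      "continuous_map ?T X (\<lambda>z. eval_term (snd e) (fst z) (F (snd z)))"
      using subsetD[OF E that] by (auto simp only: mem_Times_iff intro!: Fcont)
  qed
  \<comment> \<open>Intersecting with the whole space gives the intended set also when
    \<open>E\<close> is empty.\<close>
  let ?S = "topspace ?T \<inter> (\<Inter>e\<in>E. {z \<in> topspace ?T. eval_term (fst e) (fst z) (F (snd z)) = eval_term (snd e) (fst z) (F (snd z))})"
  have "closedin ?T ?S"
  proof (cases "E = {}")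
    case False
    then show ?thesis using cl by (intro closedin_Int closedin_topspace closedin_INT) auto
  next
    case True
    then show ?thesis by (simp only: INT_empty Int_UNIV_right closedin_topspace)
  qed
  moreover have "fst ` ?S = {y \<in> topspace Y. \<exists>f.
     (\<forall>i. continuous_map P X (f i) \<and> f i \<in> extensional (topspace P)) \<and>
     (\<forall>(t,u)\<in>E. eval_term t y f = eval_term u y f)}" (is "_ = ?R")
  proof (intro equalityI subsetI)
    fix y assume "y \<in> fst ` ?S"
    then obtain z where "z \<in> ?S" "y = fst z" by (rule imageE)
    then have "(y, snd z) \<in> ?S" by (simp only: prod.collapse)
    then obtain c where yc: "(y, c) \<in> ?S" by (rule that)
    then have "range c \<subseteq> K" "y \<in> topspace Y"
      by (auto simp: topspace_seq_topology simp del: topspace_product_topology)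
    then have "\<forall>i. continuous_map P X (F c i) \<and> F c i \<in> extensional (topspace P)"
      unfolding F_def by (intro allI s) auto
    moreover have "\<forall>(t,u)\<in>E. eval_term t y (F c) = eval_term u y (F c)" using yc by auto
    ultimately show "y \<in> ?R" using \<open>y \<in> topspace Y\<close> by blast
  next
    fix y assume "y \<in> ?R"
    then obtain f where y: "y \<in> topspace Y"
      and f: "\<And>i. continuous_map P X (f i) \<and> f i \<in> extensional (topspace P)"
      and eqs: "\<forall>(t,u)\<in>E. eval_term t y f = eval_term u y f" by blast
    have "\<forall>i. \<exists>c. range c \<subseteq> K \<and> s c = f i" using surj f by blast
    then obtain c where c: "\<And>i. range (c i) \<subseteq> K \<and> s (c i) = f i" by (auto dest!: choice)
    define b where "b n = c (fst (prod_decode n)) (snd (prod_decode n))" for n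
    have "F b = f" unfolding F_def b_def using c by auto
    moreover have "range b \<subseteq> K" unfolding b_def using c by blast
    then have "(y, b) \<in> topspace ?T"
      using y by (auto simp: topspace_seq_topology simp del: topspace_product_topology)
    ultimately have "(y, b) \<in> ?S" using eqs by auto
    then show "y \<in> fst ` ?S" by force
  qed
  ultimately show ?thesis unfolding kappa_suslin_def by blast
qed

section \<open>Carrying the Baire property from the reals to other Polish spaces\<close>

lemma baire_property_homeomorphic_image:
  assumes h: "homeomorphic_map Y Z h" and A: "A \<subseteq> topspace Y" "baire_property Y A"
  shows "baire_property Z (h ` A)"
proof -
  obtain U F where U: "openin Y U" and F: "countable F" "\<And>T. T \<in> F \<Longrightarrow> nowhere_dense_in Y T"
    "(A \<union> U) - (A \<inter> U) \<subseteq> \<Union>F"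
    using A(2) unfolding baire_property_def meager_in_def by blast
  have inj: "inj_on h (topspace Y)" using h by (simp add: homeomorphic_eq_everything_map)
  have sub: "U \<subseteq> topspace Y" using U by (rule openin_subset)
  have "nowhere_dense_in Z (h ` T)" if "T \<in> F" for T
  proof -
    have T: "T \<subseteq> topspace Y" "Y interior_of (Y closure_of T) = {}"
      using F(2)[OF that] unfolding nowhere_dense_in_def by auto
    have "Z interior_of (Z closure_of h ` T) = h ` (Y interior_of (Y closure_of T))"
      using homeomorphic_map_closure_of[OF h T(1)] homeomorphic_map_interior_of[OF h closure_of_subset_topspace]
      by simp
    then show ?thesis
      using T(2) image_mono[OF T(1), of h] homeomorphic_imp_surjective_map[OF h]
      unfolding nowhere_dense_in_def by simp
  qed
  moreover have "(h ` A \<union> h ` U) - (h ` A \<inter> h ` U) \<subseteq> \<Union>((`) h ` F)"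
  proof -
    have "h ` A \<inter> h ` U = h ` (A \<inter> U)" using inj A(1) sub by (simp add: inj_on_image_Int)
    then have "(h ` A \<union> h ` U) - (h ` A \<inter> h ` U) \<subseteq> h ` ((A \<union> U) - (A \<inter> U))" by blast
    also have "\<dots> \<subseteq> h ` (\<Union>F)" using F(3) by (rule image_mono)
    finally show ?thesis by (simp add: image_Union)
  qed
  ultimately have "meager_in Z ((h ` A \<union> h ` U) - (h ` A \<inter> h ` U))"
    unfolding meager_in_def using F(1) by (intro exI[of _ "(`) h ` F"]) auto
  moreover have "openin Z (h ` U)" using homeomorphic_map_openness[OF h sub] U by simp
  ultimately show ?thesis unfolding baire_property_def by blast
qed

lemma kappa_suslin_homeomorphic_image:
  assumes hg: "homeomorphic_maps Y Z h g" and A: "kappa_suslin K Y A"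
  shows "kappa_suslin K Z (h ` A)"
proof -
  let ?Y = "prod_topology Y (seq_topology K)" and ?Z = "prod_topology Z (seq_topology K)"
  obtain D where D: "closedin ?Y D" "fst ` D = A" using A unfolding kappa_suslin_def by blast
  have g: "continuous_map Z Y g" and h: "continuous_map Y Z h"
    and gh: "\<And>y. y \<in> topspace Y \<Longrightarrow> g (h y) = y" "\<And>z. z \<in> topspace Z \<Longrightarrow> h (g z) = z"
    using hg unfolding homeomorphic_maps_def by auto
  have "continuous_map ?Z Y (g \<circ> fst)" by (rule continuous_map_compose[OF continuous_map_fst g])
  then have "continuous_map ?Z ?Y (\<lambda>w. (g (fst w), snd w))"
    by (intro continuous_map_pairedI continuous_map_snd) (simp add: comp_def)
  then have "closedin ?Z {w \<in> topspace ?Z. (g (fst w), snd w) \<in> D}"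
    using D(1) by (rule closedin_continuous_map_preimage)
  moreover have "fst ` {w \<in> topspace ?Z. (g (fst w), snd w) \<in> D} = h ` A"
  proof (intro equalityI subsetI)
    fix z assume "z \<in> fst ` {w \<in> topspace ?Z. (g (fst w), snd w) \<in> D}"
    then obtain c where c: "(z, c) \<in> topspace ?Z" "(g z, c) \<in> D" by auto
    then have "g z \<in> A" using D(2) by force
    moreover have "h (g z) = z" using gh(2) c(1) by simp
    ultimately show "z \<in> h ` A" by force
  next
    fix z assume "z \<in> h ` A"
    then obtain y c where y: "(y, c) \<in> D" "z = h y" using D(2) by force
    then have yc: "(y, c) \<in> topspace ?Y" using D(1) closedin_subset by blast
    then have "z \<in> topspace Z" using y(2) continuous_map_image_subset_topspace[OF h] by auto
    then have "(z, c) \<in> {w \<in> topspace ?Z. (g (fst w), snd w) \<in> D}" using y yc gh(1) by auto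
    then show "z \<in> fst ` {w \<in> topspace ?Z. (g (fst w), snd w) \<in> D}" by force
  qed
  ultimately show ?thesis unfolding kappa_suslin_def by blast
qed

text \<open>\<open>BP\<close> quantifies over topologies on sets of reals. An injection
  \<open>h\<close> yields a copy \<open>Z\<close> of \<open>Y\<close> there, with the topology
  pulled back along the inverse \<open>g\<close>; the conclusion is obtained for \<open>Z\<close>
  and transported back.\<close>

lemma BP_baire_property:
  fixes K :: "'k set" and Y :: "'y topology"
  assumes "BP K" "polish_space Y" "topspace Y \<lesssim> (UNIV :: real set)" "kappa_suslin K Y A" "A \<subseteq> topspace Y"
  shows "baire_property Y A"
proof -
  obtain h :: "'y \<Rightarrow> real" where h: "inj_on h (topspace Y)"
    using assms(3) unfolding lepoll_def by blast
  define g where "g = inv_into (topspace Y) h"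
  define Z where "Z = pullback_topology (h ` topspace Y) g Y"
  have gh: "g (h y) = y" if "y \<in> topspace Y" for y
    using h that by (simp add: g_def)
  have topZ: "topspace Z = h ` topspace Y"
    unfolding Z_def topspace_pullback_topology using gh by auto
  have "continuous_map Y Z h"
    unfolding Z_def
    by (rule continuous_map_pullback') (auto intro: continuous_map_eq[OF continuous_map_id] simp: gh)
  moreover have "continuous_map Z Y g"
    unfolding Z_def using continuous_map_pullback[OF continuous_map_id] by simp
  ultimately have hom: "homeomorphic_maps Y Z h g"
    unfolding homeomorphic_maps_def topZ using gh by auto
  then have "Y homeomorphic_space Z" unfolding homeomorphic_space_def by blast
  then have "polish_space Z"
    using assms(2) homeomorphic_completely_metrizable_space homeomorphic_separable_space
    unfolding polish_space_def by blast
  moreover have "kappa_suslin K Z (h ` A)"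
    using kappa_suslin_homeomorphic_image[OF hom assms(4)] .
  ultimately have "baire_property Z (h ` A)" using assms(1) unfolding BP_def by blast
  moreover have "homeomorphic_map Z Y g" using hom by (simp add: homeomorphic_maps_map)
  moreover have "h ` A \<subseteq> topspace Z" using assms(5) topZ by blast
  ultimately have "baire_property Y (g ` h ` A)" using baire_property_homeomorphic_image by blast
  moreover have "g ` h ` A = A" using gh assms(5) by (force simp: image_image)
  ultimately show ?thesis by simp
qed

lemma polish_space_seq_topology:
  "polish_space (seq_topology (UNIV :: 'b::countable set))"
  unfolding polish_space_def
proof
  show "completely_metrizable_space (seq_topology (UNIV :: 'b set))"
    unfolding completely_metrizable_space_product_topology
    by (auto intro: completely_metrizable_space_discrete_topology)
  show "separable_space (seq_topology (UNIV :: 'b set))"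
    unfolding separable_space_def
  proof (intro exI conjI)
    let ?D = "range (\<lambda>(l :: 'b list) i. if i < length l then l ! i else undefined)"
    show "countable ?D" by simp
    show "?D \<subseteq> topspace (seq_topology UNIV)" unfolding topspace_seq_topology by simp
    show "seq_topology UNIV closure_of ?D = topspace (seq_topology (UNIV :: 'b set))"
    proof (intro equalityI closure_of_subset_topspace subsetI)
      fix x :: "nat \<Rightarrow> 'b" assume x: "x \<in> topspace (seq_topology UNIV)"
      have "\<exists>y. y \<in> ?D \<and> y \<in> T" if T: "x \<in> T" "openin (seq_topology UNIV) T" for T
      proof -
        obtain n where n: "\<And>y. (\<And>i. i < n \<Longrightarrow> y i = x i) \<Longrightarrow> y \<in> T"
          using openin_seq_topology_UNIV_cylinder[OF T(2,1)] by blast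
        have "(\<lambda>i. if i < length (map x [0..<n]) then map x [0..<n] ! i else undefined) \<in> T"
          by (rule n) simp
        then show ?thesis by blast
      qed
      then show "x \<in> seq_topology UNIV closure_of ?D" unfolding in_closure_of using x by blast
    qed
  qed
qed

section \<open>Paths and singular simplices\<close>

lemma in_standard_simplex_1:
  "x \<in> standard_simplex 1 \<longleftrightarrow> (\<exists>t\<in>{0..1}. x = (\<lambda>i. if i = 0 then 1 - t else if i = 1 then t else 0))"
proof
  assume x: "x \<in> standard_simplex 1"
  have "x 0 + x 1 = 1" "\<forall>i>1. x i = 0" "0 \<le> x 1" "x 1 \<le> 1"
    using x by (auto simp: standard_simplex_def)
  then have "x = (\<lambda>i. if i = 0 then 1 - x 1 else if i = 1 then x 1 else 0)"
    by (auto simp: fun_eq_iff)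
  then show "\<exists>t\<in>{0..1}. x = (\<lambda>i. if i = 0 then 1 - t else if i = 1 then t else 0)"
    using \<open>0 \<le> x 1\<close> \<open>x 1 \<le> 1\<close> by (intro bexI[of _ "x 1"]) auto
qed (auto simp: standard_simplex_def)

lemma standard_simplex_2_sum: "x \<in> standard_simplex 2 \<Longrightarrow> x 0 + x 1 + x 2 = 1"
  by (simp add: standard_simplex_def numeral_2_eq_2)

lemma standard_simplex_range: "x \<in> standard_simplex p \<Longrightarrow> x i \<in> {0..1}"
  by (simp add: standard_simplex_def)

lemma simplical_face_in_standard_simplex_2:
  assumes "x \<in> standard_simplex 1" "k \<le> 2"
  shows "simplical_face k x \<in> standard_simplex 2"
proof -
  obtain t where t: "t \<in> {0..1}" "x = (\<lambda>i. if i = 0 then 1 - t else if i = 1 then t else 0)"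
    using assms(1) unfolding in_standard_simplex_1 by blast
  have "k = 0 \<or> k = 1 \<or> k = 2" using assms(2) by auto
  then show ?thesis
    using t by (auto simp: standard_simplex_def simplical_face_def numeral_2_eq_2)
qed

text \<open>Time is the second barycentric coordinate, so vertex 0 is the start and vertex 1 the end
  of the path. The restriction makes the simplex extensional, so that paths agreeing on the unit
  interval give the same generator of the chain group.\<close>

definition path_simplex :: "(real \<Rightarrow> 'a) \<Rightarrow> (nat \<Rightarrow> real) \<Rightarrow> 'a"
  where "path_simplex g = restrict (\<lambda>x. g (x 1)) (standard_simplex 1)"

lemma path_simplex_cong:
  "(\<And>t. t \<in> {0..1} \<Longrightarrow> g t = h t) \<Longrightarrow> path_simplex g = path_simplex h"
  unfolding path_simplex_def by (rule restrict_ext) (metis standard_simplex_range)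

lemma continuous_map_simplex_coord:
  "continuous_map (subtopology (powertop_real UNIV) (standard_simplex p)) euclideanreal (\<lambda>x. x i)"
  by (intro continuous_map_from_subtopology continuous_map_product_projection) auto

lemma singular_simplex_path_simplex:
  assumes "pathin X g"
  shows "singular_simplex 1 X (path_simplex g)"
proof -
  let ?D = "subtopology (powertop_real UNIV) (standard_simplex 1)"
  have "continuous_map ?D (subtopology euclideanreal {0..1}) (\<lambda>x. x 1)"
    unfolding continuous_map_in_subtopology
    using continuous_map_simplex_coord standard_simplex_range[of _ 1 1] by auto
  then have "continuous_map ?D X (g \<circ> (\<lambda>x. x 1))"
    using assms unfolding pathin_def by (rule continuous_map_compose)
  then have "continuous_map ?D X (path_simplex g)"
    by (rule continuous_map_eq) (simp add: path_simplex_def)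
  then show ?thesis
    by (simp add: singular_simplex_def path_simplex_def)
qed

lemma singular_simplex_1_path:
  assumes "singular_simplex 1 X f"
  obtains g where "pathin X g" "f = path_simplex g"
proof
  let ?e = "\<lambda>t (i::nat). if i = 0 then 1 - t else if i = 1 then t else (0::real)"
  let ?D = "subtopology (powertop_real UNIV) (standard_simplex 1)"
  let ?I = "subtopology euclideanreal {0..1}"
  have "continuous_map ?I euclideanreal (\<lambda>t. ?e t i)" for i :: nat
    by (cases "i = 0"; cases "i = 1") (auto intro!: continuous_intros)
  then have "continuous_map ?I (powertop_real UNIV) ?e"
    unfolding continuous_map_componentwise_UNIV by (intro allI)
  then have "continuous_map ?I ?D ?e"
    unfolding continuous_map_in_subtopology by (auto simp: standard_simplex_def)
  then show "pathin X (f \<circ> ?e)"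
    using assms unfolding pathin_def singular_simplex_def by (blast intro: continuous_map_compose)
  show "f = path_simplex (f \<circ> ?e)"
  proof
    fix x
    show "f x = path_simplex (f \<circ> ?e) x"
    proof (cases "x \<in> standard_simplex 1")
      case True
      then obtain t where "x = ?e t" unfolding in_standard_simplex_1 by blast
      then have "?e (x 1) = x" by (simp add: fun_eq_iff)
      then have "f x = (f \<circ> ?e) (x 1)" by (metis comp_apply)
      also have "\<dots> = path_simplex (f \<circ> ?e) x"
        unfolding path_simplex_def restrict_apply'[OF True] ..
      finally show ?thesis .
    next
      case False
      then show ?thesis using assms by (simp add: path_simplex_def singular_simplex_def extensional_def)
    qed
  qed
qed

text \<open>No order between \<open>a\<close> and \<open>b\<close> is presupposed: for
  \<open>a > b\<close> the piece is run through backwards, for \<open>a = b\<close> it is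
  constant.\<close>

definition seg :: "(real \<Rightarrow> 'a) \<Rightarrow> real \<Rightarrow> real \<Rightarrow> (nat \<Rightarrow> real) \<Rightarrow> 'a"
  where "seg g a b = path_simplex (\<lambda>t. g ((1 - t) * a + t * b))"

lemma convex_combination_unit_interval:
  fixes a b t :: real
  assumes "a \<in> {0..1}" "b \<in> {0..1}" "t \<in> {0..1}"
  shows "(1 - t) * a + t * b \<in> {0..1}"
  using convexD[OF convex_real_interval(5), of a 0 1 b "1 - t" t] assms by auto

lemma pathin_seg:
  assumes "pathin X g" "a \<in> {0..1}" "b \<in> {0..1}"
  shows "pathin X (\<lambda>t. g ((1 - t) * a + t * b))"
proof -
  have "continuous_map (subtopology euclideanreal {0..1}) (subtopology euclideanreal {0..1})
          (\<lambda>t. (1 - t) * a + t * b)"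
    unfolding continuous_map_in_subtopology
    using convex_combination_unit_interval[OF assms(2,3)] by (auto intro!: continuous_intros)
  from continuous_map_compose[OF this] show ?thesis
    using assms(1) by (simp add: pathin_def comp_def)
qed

lemma seg_0_1: "seg g 0 1 = path_simplex g"
  by (simp add: seg_def)

lemma seg_same: "seg g a a = path_simplex (\<lambda>_. g a)"
  by (simp add: seg_def algebra_simps)

section \<open>Boundaries of 2-chains and pieces of a path\<close>

lemma singular_boundary_1_iff:
  "singular_boundary 1 X c \<longleftrightarrow> (\<exists>d. singular_chain 2 X d \<and> chain_boundary 2 d = c)"
  by (simp add: singular_boundary_def numeral_2_eq_2)

lemma singular_boundary_0: "singular_boundary p X 0"
  unfolding singular_boundary_def singular_chain_def chain_boundary_def
  by (intro exI[of _ 0]) simp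

lemma singular_boundary_diff:
  assumes "singular_boundary p X a" "singular_boundary p X b"
  shows "singular_boundary p X (a - b)"
proof -
  obtain c d where "singular_chain (Suc p) X c" "chain_boundary (Suc p) c = a"
    "singular_chain (Suc p) X d" "chain_boundary (Suc p) d = b"
    using assms unfolding singular_boundary_def by blast
  moreover have "Poly_Mapping.keys (c - d) \<subseteq> Poly_Mapping.keys c \<union> Poly_Mapping.keys d"
    by (rule keys_diff)
  ultimately have "singular_chain (Suc p) X (c - d)" "chain_boundary (Suc p) (c - d) = a - b"
    unfolding singular_chain_def chain_boundary_def by (auto simp: frag_extend_diff)
  then show ?thesis unfolding singular_boundary_def by blast
qed

lemma singular_boundary_minus: "singular_boundary p X a \<Longrightarrow> singular_boundary p X (- a)"
  using singular_boundary_diff[OF singular_boundary_0] by force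

lemma singular_boundary_add:
  "singular_boundary p X a \<Longrightarrow> singular_boundary p X b \<Longrightarrow> singular_boundary p X (a + b)"
  using singular_boundary_diff[of p X a "- b"] singular_boundary_minus[of p X b] by simp

lemma singular_boundary_minus_commute:
  "singular_boundary p X (a - b) \<Longrightarrow> singular_boundary p X (b - a)"
  using singular_boundary_minus by force

text \<open>The affine map of the triangle onto the (degenerate) segment with vertices \<open>a, b, c\<close>,
  followed by the path. It does away with concatenation, reversal and constant paths.\<close>

lemma singular_boundary_seg_triangle:
  assumes g: "pathin X g" and "a \<in> {0..1}" "b \<in> {0..1}" "c \<in> {0..1}"
  shows "singular_boundary 1 X (frag_of (seg g a b) + frag_of (seg g b c) - frag_of (seg g a c))"
proof -
  define f where "f = restrict (\<lambda>x. g (x 0 * a + x 1 * b + x 2 * c)) (standard_simplex 2)"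
  let ?D = "subtopology (powertop_real UNIV) (standard_simplex 2)"
  have "x 0 * a + x 1 * b + x 2 * c \<in> {0..1}" if x: "x \<in> standard_simplex 2" for x
  proof -
    have "x 0 * a \<le> x 0" "x 1 * b \<le> x 1" "x 2 * c \<le> x 2"
      using assms standard_simplex_range[OF x] by (auto intro!: mult_left_le)
    then have "x 0 * a + x 1 * b + x 2 * c \<le> 1"
      using standard_simplex_2_sum[OF x] by linarith
    then show ?thesis using assms standard_simplex_range[OF x] by auto
  qed
  moreover have "continuous_map ?D euclideanreal (\<lambda>x. x 0 * a + x 1 * b + x 2 * c)"
    by (intro continuous_intros continuous_map_simplex_coord)
  ultimately have "continuous_map ?D (subtopology euclideanreal {0..1}) (\<lambda>x. x 0 * a + x 1 * b + x 2 * c)"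
    unfolding continuous_map_in_subtopology by auto
  from continuous_map_compose[OF this]
  have "continuous_map ?D X (g \<circ> (\<lambda>x. x 0 * a + x 1 * b + x 2 * c))"
    using g unfolding pathin_def by blast
  then have "continuous_map ?D X f"
    by (rule continuous_map_eq) (simp add: f_def)
  then have "singular_chain 2 X (frag_of f)"
    by (simp add: singular_chain_def singular_simplex_def f_def)
  moreover have face: "singular_face 2 k f = path_simplex (\<lambda>t. g (
      (if k = 0 then (1 - t) * b + t * c else if k = 1 then (1 - t) * a + t * c else (1 - t) * a + t * b)))"
    if "k \<le> 2" for k
  proof -
    have "(f \<circ> simplical_face k) x = g (
      (if k = 0 then (1 - x 1) * b + x 1 * c else if k = 1 then (1 - x 1) * a + x 1 * c else (1 - x 1) * a + x 1 * b))"
      if x: "x \<in> standard_simplex 1" for x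
    proof -
      have "simplical_face k x \<in> standard_simplex 2"
        using simplical_face_in_standard_simplex_2 x \<open>k \<le> 2\<close> by blast
      moreover obtain t where "x = (\<lambda>i. if i = 0 then 1 - t else if i = 1 then t else 0)"
        using x in_standard_simplex_1[of x] by auto
      moreover have "k = 0 \<or> k = 1 \<or> k = 2" using \<open>k \<le> 2\<close> by auto
      ultimately show ?thesis
        by (auto simp: f_def simplical_face_def)
    qed
    then have "restrict (f \<circ> simplical_face k) (standard_simplex 1) = restrict (\<lambda>x. g (
      (if k = 0 then (1 - x 1) * b + x 1 * c else if k = 1 then (1 - x 1) * a + x 1 * c else (1 - x 1) * a + x 1 * b)))
      (standard_simplex 1)"
      by (rule restrict_ext)
    then show ?thesis by (simp add: singular_face_def path_simplex_def)
  qed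
  moreover have "chain_boundary 2 (frag_of f) =
      frag_of (singular_face 2 0 f) - frag_of (singular_face 2 1 f) + frag_of (singular_face 2 2 f)"
    by (simp add: chain_boundary_def numeral_2_eq_2)
  then have "chain_boundary 2 (frag_of f) = frag_of (seg g a b) + frag_of (seg g b c) - frag_of (seg g a c)"
    by (simp add: face seg_def)
  ultimately show ?thesis unfolding singular_boundary_1_iff by blast
qed

text \<open>With all three vertices at \<open>a\<close> the faces of the triangle coincide, and the
  signs leave one of them.\<close>

lemma singular_boundary_seg_same:
  assumes "pathin X g" "a \<in> {0..1}"
  shows "singular_boundary 1 X (frag_of (seg g a a))"
  using singular_boundary_seg_triangle[OF assms(1), of a a a] assms(2) by simp

lemma chain_boundary_path_simplex:
  "chain_boundary 1 (frag_of (path_simplex g)) =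
     frag_of (restrict (\<lambda>_. g 1) (standard_simplex 0)) - frag_of (restrict (\<lambda>_. g 0) (standard_simplex 0))"
proof -
  have eq: "singular_face 1 k (path_simplex g) = restrict (\<lambda>_. g (1 - real k)) (standard_simplex 0)"
    if "k \<le> 1" for k
  proof -
    have "(path_simplex g \<circ> simplical_face k) x = g (1 - real k)" if x: "x \<in> standard_simplex 0" for x
    proof -
      have "x = (\<lambda>i. if i = 0 then 1 else 0)"
        using x by (auto simp: standard_simplex_def fun_eq_iff)
      moreover have "k = 0 \<or> k = 1" using that \<open>k \<le> 1\<close> by auto
      ultimately have "simplical_face k x \<in> standard_simplex 1" "simplical_face k x 1 = 1 - real k"
        by (auto simp: standard_simplex_def simplical_face_def)
      then show ?thesis by (simp add: path_simplex_def)
    qed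
    then have "restrict (path_simplex g \<circ> simplical_face k) (standard_simplex 0) =
        restrict (\<lambda>_. g (1 - real k)) (standard_simplex 0)"
      by (rule restrict_ext)
    then show ?thesis by (simp add: singular_face_def)
  qed
  show ?thesis
    using eq[of 0] eq[of 1] by (simp add: chain_boundary_def)
qed

section \<open>The homology relation is Suslin\<close>

abbreviation simplex_topology :: "nat \<Rightarrow> (nat \<Rightarrow> real) topology"
  where "simplex_topology p \<equiv> subtopology (powertop_real UNIV) (standard_simplex p)"

lemma closedin_standard_simplex: "closedin (powertop_real UNIV) (standard_simplex p)"
proof -
  let ?X = "powertop_real UNIV"
  have eq: "standard_simplex p = (\<Inter>i. {x \<in> topspace ?X. x i \<in> {0..1}}) \<inter>
      (\<Inter>i. {x \<in> topspace ?X. x i \<in> (if p < i then {0} else UNIV)}) \<inter> {x \<in> topspace ?X. (\<Sum>i\<le>p. x i) \<in> {1}}"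
    by (auto simp: standard_simplex_def set_eq_iff)
  have pr: "continuous_map ?X euclideanreal (\<lambda>x. x i)" for i
    by (rule continuous_map_product_projection) simp
  show ?thesis
    unfolding eq
    by (intro closedin_Int closedin_INT closedin_continuous_map_preimage[OF pr]
        closedin_continuous_map_preimage[OF continuous_map_sum] pr) auto
qed

lemma compact_space_simplex_topology: "compact_space (simplex_topology p)"
proof (rule compact_space_subtopology, rule closed_compactin)
  show "compactin (powertop_real UNIV) (UNIV \<rightarrow>\<^sub>E {0..1})" by (simp add: compactin_PiE)
  show "standard_simplex p \<subseteq> UNIV \<rightarrow>\<^sub>E {0..1}" by (auto simp: standard_simplex_def)
qed (rule closedin_standard_simplex)

lemma second_countable_simplex_topology: "second_countable (simplex_topology p)"
proof (rule second_countable_subtopology)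
  obtain \<B> :: "(nat \<Rightarrow> real) set set"
    where B: "countable \<B>" "topological_basis \<B>" using ex_countable_basis by blast
  have "second_countable (euclidean :: (nat \<Rightarrow> real) topology)"
    unfolding second_countable_def
  proof (intro exI conjI allI impI ballI)
    show "openin euclidean V" if "V \<in> \<B>" for V
      using topological_basis_open[OF B(2) that] by simp
    fix U x assume "openin euclidean U \<and> (x :: nat \<Rightarrow> real) \<in> U"
    then obtain V where "V \<in> \<B>" "x \<in> V" "V \<subseteq> U" using topological_basisE[OF B(2)] by (metis open_openin)
    then show "\<exists>V\<in>\<B>. x \<in> V \<and> V \<subseteq> U" by blast
  qed (rule B(1))
  then show "second_countable (powertop_real (UNIV :: nat set))" by (simp add: euclidean_product_topology)
qed

lemma singular_simplex_iff:
  "singular_simplex p X f \<longleftrightarrow>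
     continuous_map (simplex_topology p) X f \<and> f \<in> extensional (topspace (simplex_topology p))"
  by (simp add: singular_simplex_def)

section \<open>Equality of formal sums as a finite pattern\<close>

lemma frag_cmul_sum_left: "frag_cmul (\<Sum>j\<in>A. n j) c = (\<Sum>j\<in>A. frag_cmul (n j) c)"
  by (induction A rule: infinite_finite_induct) (auto simp: frag_cmul_distrib)

text \<open>A formal sum vanishes when the coefficients over each class of equal generators cancel,
  and \<open>e\<close> sends every index to a representative of its class. Conversely
  \<open>e\<close> may identify fewer indices than \<open>\<tau>\<close> does: cancellation over its
  fibres still certifies the identity. So only equations between generators occur, never
  inequations, which would spoil closedness.\<close>

lemma frag_sum_eq_0_iff:
  fixes n :: "'j \<Rightarrow> int" and \<tau> :: "'j \<Rightarrow> 'b"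
  assumes J: "finite J"
  shows "(\<Sum>j\<in>J. frag_cmul (n j) (frag_of (\<tau> j))) = 0 \<longleftrightarrow>
     (\<exists>e\<in>J \<rightarrow>\<^sub>E J. (\<forall>v\<in>J. (\<Sum>j\<in>{j\<in>J. e j = v}. n j) = 0) \<and> (\<forall>j\<in>J. \<tau> (e j) = \<tau> j))"
    (is "?S = 0 \<longleftrightarrow> ?R")
proof
  assume S: "?S = 0"
  \<comment> \<open>The choice depends on \<open>\<tau> j\<close> only, so indices with equal
    generators get the same representative.\<close>
  define e where "e = restrict (\<lambda>j. SOME i. i \<in> J \<and> \<tau> i = \<tau> j) J"
  have e: "e j \<in> J \<and> \<tau> (e j) = \<tau> j" if "j \<in> J" for j
    using someI[of "\<lambda>i. i \<in> J \<and> \<tau> i = \<tau> j" j] that by (simp add: e_def)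
  have e_eq: "e i = e j" if "i \<in> J" "j \<in> J" "\<tau> i = \<tau> j" for i j
    using that by (simp add: e_def)
  have "(\<Sum>j\<in>{j\<in>J. e j = v}. n j) = 0" if v: "v \<in> J" for v
  proof (cases "\<exists>i\<in>J. e i = v")
    case True
    then obtain i where i: "i \<in> J" "e i = v" by blast
    have "{j\<in>J. e j = v} = {j\<in>J. \<tau> j = \<tau> v}"
      using e e_eq i by (metis (lifting))
    then have "(\<Sum>j\<in>{j\<in>J. e j = v}. n j) = (\<Sum>j\<in>J. if \<tau> j = \<tau> v then n j else 0)"
      using J by (simp add: sum.inter_filter)
    also have "\<dots> = Poly_Mapping.lookup ?S (\<tau> v)"
      unfolding lookup_sum lookup_frag_cmul lookup_frag_of by (intro sum.cong) auto
    finally show ?thesis using S by simp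
  next
    case False
    then have "{j\<in>J. e j = v} = {}" by blast
    then show ?thesis by (simp only: sum.empty)
  qed
  moreover have "e \<in> J \<rightarrow>\<^sub>E J" using e by (auto simp: e_def)
  ultimately show ?R using e by blast
next
  assume ?R
  then obtain e where e: "e \<in> J \<rightarrow>\<^sub>E J" "\<And>v. v \<in> J \<Longrightarrow> (\<Sum>j\<in>{j\<in>J. e j = v}. n j) = 0"
    "\<And>j. j \<in> J \<Longrightarrow> \<tau> (e j) = \<tau> j" by blast
  have eJ: "e ` J \<subseteq> J" using e(1) by auto
  have "?S = (\<Sum>j\<in>J. frag_cmul (n j) (frag_of (\<tau> (e j))))"
    by (rule sum.cong) (simp_all add: e(3))
  also have "\<dots> = (\<Sum>v\<in>J. \<Sum>j\<in>{j\<in>J. e j = v}. frag_cmul (n j) (frag_of (\<tau> (e j))))"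
    using sum.group[OF J J eJ, of "\<lambda>j. frag_cmul (n j) (frag_of (\<tau> (e j)))"] by simp
  also have "\<dots> = (\<Sum>v\<in>J. frag_cmul (\<Sum>j\<in>{j\<in>J. e j = v}. n j) (frag_of (\<tau> v)))"
    unfolding frag_cmul_sum_left by (intro sum.cong) auto
  also have "\<dots> = 0" by (intro sum.neutral ballI) (simp only: e(2) frag_cmul_zero)
  finally show "?S = 0" .
qed

definition boundary_sum :: "nat \<Rightarrow> (nat \<Rightarrow> int) \<Rightarrow> (nat \<Rightarrow> (nat \<Rightarrow> real) \<Rightarrow> 'a) \<Rightarrow> 'a chain"
  where "boundary_sum m n f =
    (\<Sum>i\<in>{1..m}. \<Sum>k\<le>2. frag_cmul (n i * (-1) ^ k) (frag_of (singular_face 2 k (f i))))"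

lemma chain_boundary_2_sum:
  "chain_boundary 2 (\<Sum>i\<in>{1..m}. frag_cmul (n i) (frag_of (f i))) = boundary_sum m n f"
  unfolding chain_boundary_def boundary_sum_def
  by (simp add: frag_extend_sum frag_extend_cmul frag_cmul_sum comp_def)

text \<open>Coefficients are separated from simplices: the former range over countably many
  extensional tuples, the latter become the unknowns. The family \<open>f\<close> is total, padded
  with a constant simplex, so that every unknown is constrained in the same way.\<close>

lemma singular_boundary_1_sum:
  assumes "topspace X \<noteq> {}"
  shows "singular_boundary 1 X c \<longleftrightarrow>
    (\<exists>m. \<exists>n\<in>{1..m} \<rightarrow>\<^sub>E UNIV. \<exists>f. (\<forall>i. singular_simplex 2 X (f i)) \<and> c = boundary_sum m n f)"
proof
  assume "singular_boundary 1 X c"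
  then obtain d where d: "singular_chain 2 X d" "chain_boundary 2 d = c"
    unfolding singular_boundary_1_iff by blast
  obtain a where a: "a \<in> topspace X" using assms by blast
  define \<sigma> where "\<sigma> = restrict (\<lambda>_. a) (standard_simplex 2)"
  have \<sigma>: "singular_simplex 2 X \<sigma>"
    unfolding singular_simplex_iff \<sigma>_def using a
    by (auto intro: continuous_map_eq[of _ X "\<lambda>_. a"])
  define m where "m = card (Poly_Mapping.keys d)"
  obtain h where h: "bij_betw h {1..m} (Poly_Mapping.keys d)"
    using ex_bij_betw_nat_finite_1[OF finite_keys] unfolding m_def by blast
  define f where "f i = (if i \<in> {1..m} then h i else \<sigma>)" for i
  define n where "n = restrict (\<lambda>i. Poly_Mapping.lookup d (h i)) {1..m}"
  have "singular_simplex 2 X (f i)" for i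
  proof (cases "i \<in> {1..m}")
    case True
    then have "h i \<in> Poly_Mapping.keys d" using h by (simp add: bij_betw_apply)
    then show ?thesis using d(1) True unfolding singular_chain_def f_def by auto
  next
    case False
    then show ?thesis using \<sigma> unfolding f_def if_not_P[OF False] by simp
  qed
  moreover have "d = (\<Sum>i\<in>{1..m}. frag_cmul (n i) (frag_of (f i)))"
  proof -
    have "d = (\<Sum>\<rho>\<in>Poly_Mapping.keys d. frag_cmul (Poly_Mapping.lookup d \<rho>) (frag_of \<rho>))"
      using frag_expansion[of d] unfolding frag_extend_def .
    also have "\<dots> = (\<Sum>i\<in>{1..m}. frag_cmul (Poly_Mapping.lookup d (h i)) (frag_of (h i)))"
      by (rule sum.reindex_bij_betw[OF h, symmetric])
    also have "\<dots> = (\<Sum>i\<in>{1..m}. frag_cmul (n i) (frag_of (f i)))"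
      by (intro sum.cong) (auto simp: n_def f_def)
    finally show ?thesis .
  qed
  then have "c = boundary_sum m n f" using d(2) chain_boundary_2_sum by metis
  moreover have "n \<in> {1..m} \<rightarrow>\<^sub>E UNIV" unfolding n_def by simp
  ultimately show "\<exists>m. \<exists>n\<in>{1..m} \<rightarrow>\<^sub>E UNIV. \<exists>f. (\<forall>i. singular_simplex 2 X (f i)) \<and> c = boundary_sum m n f"
    by (intro exI[of _ m] bexI[of _ n] exI[of _ f] conjI allI)
next
  assume "\<exists>m. \<exists>n\<in>{1..m} \<rightarrow>\<^sub>E UNIV. \<exists>f. (\<forall>i. singular_simplex 2 X (f i)) \<and> c = boundary_sum m n f"
  then obtain m n f where f: "\<And>i. singular_simplex 2 X (f i)" and c: "c = boundary_sum m n f" by blast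
  have "Poly_Mapping.keys (\<Sum>i\<in>{1..m}. frag_cmul (n i) (frag_of (f i))) \<subseteq>
      (\<Union>i\<in>{1..m}. Poly_Mapping.keys (frag_cmul (n i) (frag_of (f i))))"
    by (rule keys_sum)
  also have "\<dots> \<subseteq> Collect (singular_simplex 2 X)" using f keys_cmul by fastforce
  finally have "singular_chain 2 X (\<Sum>i\<in>{1..m}. frag_cmul (n i) (frag_of (f i)))"
    unfolding singular_chain_def .
  then show "singular_boundary 1 X c"
    unfolding singular_boundary_1_iff c using chain_boundary_2_sum by blast
qed

text \<open>The terms of the identity \<open>\<sigma> - \<rho> = \<partial> (\<Sum>i. n i f i)\<close>: index \<open>(0, 0)\<close> stands for
  \<open>\<sigma>\<close>, \<open>(0, 1)\<close> for \<open>\<rho>\<close> and \<open>(i, k)\<close> with \<open>i > 0\<close> for the \<open>k\<close>-th face of \<open>f i\<close>.\<close>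

definition term_index :: "nat \<Rightarrow> (nat \<times> nat) set"
  where "term_index m = {0} \<times> {0,1} \<union> {1..m} \<times> {..2}"

definition term_coeff :: "(nat \<Rightarrow> int) \<Rightarrow> nat \<times> nat \<Rightarrow> int"
  where "term_coeff n j = (if fst j = 0 then (-1) ^ snd j else - (n (fst j) * (-1) ^ snd j))"

definition term_simplex ::
  "((nat \<Rightarrow> real) \<Rightarrow> 'a) \<Rightarrow> ((nat \<Rightarrow> real) \<Rightarrow> 'a) \<Rightarrow> (nat \<Rightarrow> (nat \<Rightarrow> real) \<Rightarrow> 'a) \<Rightarrow> nat \<times> nat \<Rightarrow> (nat \<Rightarrow> real) \<Rightarrow> 'a"
  where "term_simplex \<sigma> \<rho> f j =
     (if fst j = 0 then (if snd j = 0 then \<sigma> else \<rho>) else singular_face 2 (snd j) (f (fst j)))"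

lemma finite_term_index: "finite (term_index m)"
  by (simp add: term_index_def)

lemma diff_boundary_sum:
  "frag_of \<sigma> - frag_of \<rho> - boundary_sum m n f =
     (\<Sum>j\<in>term_index m. frag_cmul (term_coeff n j) (frag_of (term_simplex \<sigma> \<rho> f j)))"
proof -
  let ?g = "\<lambda>j. frag_cmul (term_coeff n j) (frag_of (term_simplex \<sigma> \<rho> f j))"
  have "sum ?g (term_index m) = sum ?g ({0} \<times> {0,1}) + sum ?g ({1..m} \<times> {..2})"
    unfolding term_index_def by (rule sum.union_disjoint) auto
  moreover have "sum ?g ({0} \<times> {0,1}) = frag_of \<sigma> - frag_of \<rho>"
    by (simp add: term_coeff_def term_simplex_def flip: sum.cartesian_product)
  moreover have "sum ?g ({1..m} \<times> {..2}) = - boundary_sum m n f"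
    unfolding boundary_sum_def sum_negf[symmetric] sum.cartesian_product
    by (rule sum.cong) (auto simp: term_coeff_def term_simplex_def)
  ultimately show ?thesis by simp
qed

definition term_patterns :: "(nat \<times> (nat \<Rightarrow> int) \<times> (nat \<times> nat \<Rightarrow> nat \<times> nat)) set"
  where "term_patterns = (SIGMA m:UNIV. ({1..m} \<rightarrow>\<^sub>E UNIV) \<times> (term_index m \<rightarrow>\<^sub>E term_index m))"

lemma countable_term_patterns: "countable term_patterns"
  unfolding term_patterns_def
  by (intro countable_SIGMA countable_PiE finite_term_index countable_finite[OF finite_term_index]) auto

text \<open>The quantifiers are sorted. The number of simplices, the coefficients and the
  identifications move outside, as a countable union with a test that does not involve
  \<open>X\<close>; inside remains only the existence of 2-simplices subject to equations.\<close>

lemma homologous_iff_pattern: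
  assumes "topspace X \<noteq> {}"
  shows "singular_boundary 1 X (frag_of \<sigma> - frag_of \<rho>) \<longleftrightarrow>
    (\<exists>(m, n, e)\<in>term_patterns.
       (\<forall>v\<in>term_index m. (\<Sum>j\<in>{j\<in>term_index m. e j = v}. term_coeff n j) = 0) \<and>
       (\<exists>f. (\<forall>i. singular_simplex 2 X (f i)) \<and>
          (\<forall>j\<in>term_index m. term_simplex \<sigma> \<rho> f (e j) = term_simplex \<sigma> \<rho> f j)))" (is "_ \<longleftrightarrow> ?R")
proof -
  have "frag_of \<sigma> - frag_of \<rho> = boundary_sum m n f \<longleftrightarrow>
    (\<exists>e\<in>term_index m \<rightarrow>\<^sub>E term_index m.
       (\<forall>v\<in>term_index m. (\<Sum>j\<in>{j\<in>term_index m. e j = v}. term_coeff n j) = 0) \<and>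
       (\<forall>j\<in>term_index m. term_simplex \<sigma> \<rho> f (e j) = term_simplex \<sigma> \<rho> f j))" for m n f
  proof -
    have "frag_of \<sigma> - frag_of \<rho> = boundary_sum m n f \<longleftrightarrow> frag_of \<sigma> - frag_of \<rho> - boundary_sum m n f = 0" by simp
    then show ?thesis
      unfolding diff_boundary_sum frag_sum_eq_0_iff[OF finite_term_index] .
  qed
  then have "singular_boundary 1 X (frag_of \<sigma> - frag_of \<rho>) \<longleftrightarrow>
    (\<exists>m. \<exists>n\<in>{1..m} \<rightarrow>\<^sub>E UNIV. \<exists>f. (\<forall>i. singular_simplex 2 X (f i)) \<and>
      (\<exists>e\<in>term_index m \<rightarrow>\<^sub>E term_index m.
       (\<forall>v\<in>term_index m. (\<Sum>j\<in>{j\<in>term_index m. e j = v}. term_coeff n j) = 0) \<and>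
       (\<forall>j\<in>term_index m. term_simplex \<sigma> \<rho> f (e j) = term_simplex \<sigma> \<rho> f j)))" (is "_ \<longleftrightarrow> ?L")
    unfolding singular_boundary_1_sum[OF assms] by (simp only:)
  also have "?L \<longleftrightarrow> ?R"
  proof
    assume ?L
    then obtain m n f e where *: "n \<in> {1..m} \<rightarrow>\<^sub>E UNIV" "e \<in> term_index m \<rightarrow>\<^sub>E term_index m"
      "\<forall>i. singular_simplex 2 X (f i)"
      "\<forall>v\<in>term_index m. (\<Sum>j\<in>{j\<in>term_index m. e j = v}. term_coeff n j) = 0"
      "\<forall>j\<in>term_index m. term_simplex \<sigma> \<rho> f (e j) = term_simplex \<sigma> \<rho> f j"
      by (elim exE bexE conjE)
    have "(m, n, e) \<in> term_patterns"
      unfolding term_patterns_def by (intro SigmaI UNIV_I *)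
    then show ?R
      by (rule bexI[rotated]) (unfold prod.case, intro conjI exI[of _ f] *)
  next
    assume ?R
    then obtain p where p: "p \<in> term_patterns" "case p of (m, n, e) \<Rightarrow>
       (\<forall>v\<in>term_index m. (\<Sum>j\<in>{j\<in>term_index m. e j = v}. term_coeff n j) = 0) \<and>
       (\<exists>f. (\<forall>i. singular_simplex 2 X (f i)) \<and>
          (\<forall>j\<in>term_index m. term_simplex \<sigma> \<rho> f (e j) = term_simplex \<sigma> \<rho> f j))"
      by (elim bexE)
    obtain m n e where pe: "p = (m, n, e)" by (cases p)
    then obtain f where *: "\<forall>i. singular_simplex 2 X (f i)"
      "\<forall>v\<in>term_index m. (\<Sum>j\<in>{j\<in>term_index m. e j = v}. term_coeff n j) = 0"
      "\<forall>j\<in>term_index m. term_simplex \<sigma> \<rho> f (e j) = term_simplex \<sigma> \<rho> f j"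
      using p(2) unfolding pe prod.case by (elim exE conjE)
    have "n \<in> {1..m} \<rightarrow>\<^sub>E UNIV" "e \<in> term_index m \<rightarrow>\<^sub>E term_index m"
      using p(1) unfolding pe term_patterns_def by (simp_all only: mem_Sigma_iff mem_Times_iff fst_conv snd_conv)
    then show ?L
      by (intro exI[of _ m] bexI[of _ n] exI[of _ f] bexI[of _ e] conjI *)
  qed
  finally show ?thesis .
qed

text \<open>An equality of 1-simplices is split into its values at the points \<open>q\<close>. A
  face of an unknown 2-simplex at \<open>q\<close> is that simplex at the image of \<open>q\<close>
  under the face map, so faces need no unknowns of their own.\<close>

definition point_term ::
  "('y \<Rightarrow> real \<Rightarrow> 'a) \<Rightarrow> ('y \<Rightarrow> real \<Rightarrow> 'a) \<Rightarrow> nat \<times> nat \<Rightarrow> (nat \<Rightarrow> real) \<Rightarrow> ('y \<Rightarrow> 'a) + nat \<times> (nat \<Rightarrow> real)"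
  where "point_term A B j q =
     (if fst j = 0 then Inl (\<lambda>y. if snd j = 0 then A y (q 1) else B y (q 1))
      else Inr (fst j, simplical_face (snd j) q))"

lemma term_simplex_point:
  assumes "q \<in> standard_simplex 1"
  shows "term_simplex (path_simplex (A y)) (path_simplex (B y)) f j q = eval_term (point_term A B j q) y f"
  using assms by (simp add: term_simplex_def point_term_def path_simplex_def singular_face_def)

lemma term_simplex_extensional:
  "term_simplex (path_simplex a) (path_simplex b) f j \<in> extensional (standard_simplex 1)"
  by (simp add: term_simplex_def path_simplex_def singular_face_def)

text \<open>Each pattern passing the coefficient test \<open>good\<close> contributes the
  solvability set of a system of equations, and the countable union of these is Suslin. Since the
  equations are pointwise, continuity of \<open>A\<close> and \<open>B\<close> in the parameter is
  needed only for each time separately.\<close>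

lemma kappa_suslin_homologous:
  fixes K :: "'k set" and X :: "'a topology" and Y :: "'y topology"
  assumes K: "infinite K" and X: "kappa_polish K X" "topspace X \<noteq> {}"
    and A: "\<And>t. t \<in> {0..1} \<Longrightarrow> continuous_map Y X (\<lambda>y. A y t)"
    and B: "\<And>t. t \<in> {0..1} \<Longrightarrow> continuous_map Y X (\<lambda>y. B y t)"
  shows "kappa_suslin K Y {y \<in> topspace Y.
    singular_boundary 1 X (frag_of (path_simplex (A y)) - frag_of (path_simplex (B y)))}"
proof -
  define good where "good = (\<lambda>(m, n, e). \<forall>v\<in>term_index m. (\<Sum>j\<in>{j\<in>term_index m. e j = v}. term_coeff n j) = 0)"
  define E where "E = (\<lambda>(m :: nat, n :: nat \<Rightarrow> int, e :: nat \<times> nat \<Rightarrow> nat \<times> nat).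
     \<Union>j\<in>term_index m. (\<lambda>q. (point_term A B (e j) q, point_term A B j q)) ` standard_simplex 1)"
  define W where "W p = {y \<in> topspace Y. \<exists>f.
     (\<forall>i. continuous_map (simplex_topology 2) X (f i) \<and> f i \<in> extensional (topspace (simplex_topology 2))) \<and>
     (\<forall>(t,u)\<in>E p. eval_term t y f = eval_term u y f)}" for p
  have valid: "point_term A B j q \<in> Collect (continuous_map Y X) <+> UNIV \<times> topspace (simplex_topology 2)"
    if j: "j \<in> term_index m" and q: "q \<in> standard_simplex 1" for m j q
  proof (cases "fst j = 0")
    case True
    have "q 1 \<in> {0..1}" using standard_simplex_range[OF q] .
    then show ?thesis using True A B by (auto simp: point_term_def)
  next
    case False
    then have "snd j \<le> 2" using j by (auto simp: term_index_def)
    then show ?thesis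
      using False simplical_face_in_standard_simplex_2[OF q] by (simp add: point_term_def InrI)
  qed
  have "kappa_suslin K Y (W p)" if p: "p \<in> term_patterns" for p
    unfolding W_def
  proof (rule kappa_suslin_solvable[OF K compact_space_simplex_topology second_countable_simplex_topology X])
    obtain m n e where pe: "p = (m, n, e)" by (cases p)
    have "e \<in> term_index m \<rightarrow>\<^sub>E term_index m" using p by (auto simp: pe term_patterns_def)
    then have "e j \<in> term_index m" if "j \<in> term_index m" for j using that by blast
    then show "E p \<subseteq> (Collect (continuous_map Y X) <+> UNIV \<times> topspace (simplex_topology 2)) \<times>
        (Collect (continuous_map Y X) <+> UNIV \<times> topspace (simplex_topology 2))"
      unfolding pe E_def prod.case using valid[where m = m] by (intro subsetI) (elim UN_E imageE, simp only: mem_Times_iff fst_conv snd_conv)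
  qed
  then have "kappa_suslin K Y (\<Union>p\<in>{p\<in>term_patterns. good p}. W p)"
    by (intro kappa_suslin_UN countable_lepoll_infinite[OF _ K] countable_subset[OF _ countable_term_patterns]) auto
  moreover have "(\<Union>p\<in>{p\<in>term_patterns. good p}. W p) = {y \<in> topspace Y.
    singular_boundary 1 X (frag_of (path_simplex (A y)) - frag_of (path_simplex (B y)))}"
  proof -
    have eqs: "(\<forall>(t,u)\<in>E (m, n, e). eval_term t y f = eval_term u y f) \<longleftrightarrow>
      (\<forall>j\<in>term_index m. term_simplex (path_simplex (A y)) (path_simplex (B y)) f (e j) =
         term_simplex (path_simplex (A y)) (path_simplex (B y)) f j)" (is "?L \<longleftrightarrow> ?R") for m n e y f
    proof -
      have "?L \<longleftrightarrow> (\<forall>j\<in>term_index m. \<forall>q\<in>standard_simplex 1.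
          eval_term (point_term A B (e j) q) y f = eval_term (point_term A B j q) y f)"
        unfolding E_def by simp
      also have "\<dots> \<longleftrightarrow> (\<forall>j\<in>term_index m. \<forall>q\<in>standard_simplex 1.
          term_simplex (path_simplex (A y)) (path_simplex (B y)) f (e j) q =
          term_simplex (path_simplex (A y)) (path_simplex (B y)) f j q)"
        by (intro ball_cong refl) (simp only: term_simplex_point)
      \<comment> \<open>Both sides are extensional, so agreement on the standard simplex is
        equality.\<close>
      also have "\<dots> \<longleftrightarrow> ?R"
        using extensionalityI[OF term_simplex_extensional term_simplex_extensional] by metis
      finally show ?thesis .
    qed
    have eq: "(good p \<and> y \<in> W p) \<longleftrightarrow> y \<in> topspace Y \<and> (case p of (m, n, e) \<Rightarrow>
       (\<forall>v\<in>term_index m. (\<Sum>j\<in>{j\<in>term_index m. e j = v}. term_coeff n j) = 0) \<and>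
       (\<exists>f. (\<forall>i. singular_simplex 2 X (f i)) \<and>
          (\<forall>j\<in>term_index m. term_simplex (path_simplex (A y)) (path_simplex (B y)) f (e j) =
             term_simplex (path_simplex (A y)) (path_simplex (B y)) f j)))" for p y
    proof -
      obtain m n e where pe: "p = (m, n, e)" by (cases p)
      show ?thesis
        unfolding pe good_def W_def mem_Collect_eq prod.case eqs singular_simplex_iff
        by (simp only: conj_ac)
    qed
    have gen: "(\<Union>p\<in>{p\<in>term_patterns. good p}. W p) = {y \<in> topspace Y. \<exists>p\<in>term_patterns. Q y p}"
      if "\<And>p y. (good p \<and> y \<in> W p) \<longleftrightarrow> y \<in> topspace Y \<and> Q y p" for Q
    proof (intro equalityI subsetI)
      fix y assume "y \<in> (\<Union>p\<in>{p\<in>term_patterns. good p}. W p)"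
      then obtain p where p: "p \<in> term_patterns" "good p" "y \<in> W p" by (elim UN_E CollectE conjE)
      then have "y \<in> topspace Y \<and> Q y p" by (intro iffD1[OF that] conjI)
      then show "y \<in> {y \<in> topspace Y. \<exists>p\<in>term_patterns. Q y p}" using p(1) by (intro CollectI) auto
    next
      fix y assume "y \<in> {y \<in> topspace Y. \<exists>p\<in>term_patterns. Q y p}"
      then obtain p where p: "p \<in> term_patterns" "y \<in> topspace Y" "Q y p" by (elim CollectE conjE bexE)
      then have "good p \<and> y \<in> W p" by (intro iffD2[OF that] conjI)
      then show "y \<in> (\<Union>p\<in>{p\<in>term_patterns. good p}. W p)" using p(1) by (intro UN_I[of p]) auto
    qed
    show ?thesis
      unfolding homologous_iff_pattern[OF X(2)] by (rule gen, rule eq)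
  qed
  ultimately show ?thesis by simp
qed

section \<open>Infinite concatenations of loops\<close>

lemma carrier_cycle_group: "carrier (cycle_group p X) = Collect (singular_cycle p X)"
proof -
  have grp: "group (chain_group p X)" unfolding chain_group_def by simp
  have sub: "subgroup (Collect (singular_cycle p X)) (chain_group p X)"
  proof (rule group.subgroupI[OF grp])
    show "Collect (singular_cycle p X) \<subseteq> carrier (chain_group p X)"
      by (auto simp: chain_group_def singular_cycle_def singular_chain_def)
    have "singular_cycle p X 0"
      by (simp add: singular_cycle_def singular_chain_def chain_boundary_def)
    then show "Collect (singular_cycle p X) \<noteq> {}" by blast
    show "inv\<^bsub>chain_group p X\<^esub> a \<in> Collect (singular_cycle p X)" if "a \<in> Collect (singular_cycle p X)" for a
      using that by (simp add: chain_group_def singular_cycle_def singular_chain_def chain_boundary_def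
          frag_extend_minus split: if_splits)
    show "a \<otimes>\<^bsub>chain_group p X\<^esub> b \<in> Collect (singular_cycle p X)"
      if "a \<in> Collect (singular_cycle p X)" "b \<in> Collect (singular_cycle p X)" for a b
      using that Poly_Mapping.keys_add[of a b]
      by (auto simp: chain_group_def singular_cycle_def singular_chain_def chain_boundary_def
          frag_extend_add split: if_splits)
  qed
  show ?thesis
    unfolding cycle_group_def
    using group.subgroup_generated_minimal[OF grp sub order_refl]
      group.subgroup_generated_subset_carrier_subset[OF grp subgroup.subset[OF sub]] by (rule equalityI)
qed

definition homology_class :: "nat \<Rightarrow> 'a topology \<Rightarrow> 'a chain \<Rightarrow> 'a chain set"
  where "homology_class p X c = {b + c | b. singular_boundary p X b}"

lemma carrier_homology_group:
  "carrier (homology_group p X) = homology_class p X ` Collect (singular_cycle p X)"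
  unfolding homology_group_def FactGroup_def RCOSETS_def r_coset_def carrier_cycle_group homology_class_def
  by (auto simp: cycle_group_def chain_group_def)

lemma homology_class_eq_iff:
  "homology_class p X a = homology_class p X b \<longleftrightarrow> singular_boundary p X (a - b)"
proof
  assume "homology_class p X a = homology_class p X b"
  moreover have "a \<in> homology_class p X a"
    unfolding homology_class_def using singular_boundary_0 by force
  ultimately obtain c where "singular_boundary p X c" "a = c + b"
    unfolding homology_class_def by blast
  then show "singular_boundary p X (a - b)" by simp
next
  have *: "homology_class p X a \<subseteq> homology_class p X b" if "singular_boundary p X (a - b)" for a b
  proof
    fix z assume "z \<in> homology_class p X a"
    then obtain c where c: "singular_boundary p X c" "z = c + a"
      unfolding homology_class_def by blast
    then have "z = (c + (a - b)) + b" by simp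
    then show "z \<in> homology_class p X b"
      unfolding homology_class_def using singular_boundary_add[OF c(1) that] by blast
  qed
  assume "singular_boundary p X (a - b)"
  then show "homology_class p X a = homology_class p X b"
    using * singular_boundary_minus_commute by blast
qed

lemma lepoll_homology_group:
  assumes "\<And>i. i \<in> S \<Longrightarrow> singular_cycle p X (a i)"
    "\<And>i j. i \<in> S \<Longrightarrow> j \<in> S \<Longrightarrow> singular_boundary p X (a i - a j) \<Longrightarrow> i = j"
  shows "S \<lesssim> carrier (homology_group p X)"
  unfolding lepoll_def
proof (intro exI conjI)
  show "inj_on (\<lambda>i. homology_class p X (a i)) S"
    using assms(2) by (intro inj_onI) (simp only: homology_class_eq_iff)
  show "(\<lambda>i. homology_class p X (a i)) ` S \<subseteq> carrier (homology_group p X)"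
    unfolding carrier_homology_group using assms(1) by auto
qed

text \<open>\<open>R s c\<close> makes \<open>s\<close> a code for the class of \<open>c\<close>: a
  class may have many codes, but no code serves two classes.\<close>

lemma homology_group_lepoll:
  assumes "\<And>c. singular_cycle p X c \<Longrightarrow> \<exists>s\<in>S. R s c"
    "\<And>s a b. R s a \<Longrightarrow> R s b \<Longrightarrow> singular_boundary p X (a - b)"
  shows "carrier (homology_group p X) \<lesssim> S"
proof (rule lepoll_relational_full)
  fix y assume "y \<in> carrier (homology_group p X)"
  then show "\<exists>s. s \<in> S \<and> (\<exists>c. y = homology_class p X c \<and> R s c)"
    unfolding carrier_homology_group using assms(1) by blast
next
  fix s y y'
  assume "\<exists>c. y = homology_class p X c \<and> R s c" "\<exists>c. y' = homology_class p X c \<and> R s c"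
  then show "y = y'" using assms(2) homology_class_eq_iff by metis
qed

lemma singular_cycle_path_simplex:
  assumes "pathin X g" "g 0 = g 1"
  shows "singular_cycle 1 X (frag_of (path_simplex g))"
  using singular_simplex_path_simplex[OF assms(1)] chain_boundary_path_simplex[of g] assms(2)
  by (simp add: singular_cycle_def singular_chain_def)

section \<open>Joining a selection of loops at a common point\<close>

text \<open>It is meant for maps that leave \<open>x\<close> at disjoint sets of times; then at most
  one index qualifies at \<open>t\<close>, and the choice is forced.\<close>

definition wedge :: "(nat \<Rightarrow> 't \<Rightarrow> 'a) \<Rightarrow> 'a \<Rightarrow> (nat \<Rightarrow> bool) \<Rightarrow> 't \<Rightarrow> 'a"
  where "wedge \<phi> x \<alpha> t = (if \<exists>n. \<alpha> n \<and> \<phi> n t \<noteq> x then \<phi> (SOME n. \<alpha> n \<and> \<phi> n t \<noteq> x) t else x)"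

lemma wedge_base: "(\<And>n. \<phi> n t = x) \<Longrightarrow> wedge \<phi> x \<alpha> t = x"
  by (simp add: wedge_def)

lemma wedge_eq:
  assumes "\<And>m. m \<noteq> n \<Longrightarrow> \<phi> m t = x"
  shows "wedge \<phi> x \<alpha> t = (if \<alpha> n then \<phi> n t else x)"
proof (cases "\<alpha> n \<and> \<phi> n t \<noteq> x")
  case True
  then have "(SOME n. \<alpha> n \<and> \<phi> n t \<noteq> x) = n"
    using assms by (intro some_equality) auto
  then show ?thesis using True by (auto simp: wedge_def)
next
  case False
  then have "\<not> (\<exists>n. \<alpha> n \<and> \<phi> n t \<noteq> x)" using assms by metis
  then show ?thesis using False by (auto simp: wedge_def)
qed

lemma wedge_cong:
  assumes "\<And>n. \<phi> n t \<noteq> x \<Longrightarrow> \<alpha> n = \<beta> n"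
  shows "wedge \<phi> x \<alpha> t = wedge \<phi> x \<beta> t"
proof -
  have "(\<lambda>n. \<alpha> n \<and> \<phi> n t \<noteq> x) = (\<lambda>n. \<beta> n \<and> \<phi> n t \<noteq> x)" using assms by blast
  then show ?thesis unfolding wedge_def by metis
qed

text \<open>If \<open>x\<close> lies outside \<open>U\<close>, the preimage of \<open>U\<close> is
  the union of the preimages under the selected loops. If \<open>x\<close> lies in \<open>U\<close>,
  all but finitely many loops stay in \<open>U\<close>, and the preimage is a finite
  intersection.\<close>

lemma pathin_wedge:
  assumes x: "x \<in> topspace X"
    and \<phi>: "\<And>n. pathin X (\<phi> n)"
    and disj: "\<And>n m t. \<phi> n t \<noteq> x \<Longrightarrow> \<phi> m t \<noteq> x \<Longrightarrow> n = m"
    and small: "\<And>U. openin X U \<Longrightarrow> x \<in> U \<Longrightarrow> \<exists>N. \<forall>n\<ge>N. \<phi> n ` {0..1} \<subseteq> U"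
  shows "pathin X (wedge \<phi> x \<alpha>)"
proof -
  let ?I = "subtopology euclideanreal {0..1}"
  have wedge_cases: "wedge \<phi> x \<alpha> t = x \<and> (\<forall>n. \<alpha> n \<longrightarrow> \<phi> n t = x) \<or>
      (\<exists>n. \<alpha> n \<and> \<phi> n t \<noteq> x \<and> wedge \<phi> x \<alpha> t = \<phi> n t \<and> (\<forall>m. m \<noteq> n \<longrightarrow> \<phi> m t = x))" for t
  proof (cases "\<exists>n. \<alpha> n \<and> \<phi> n t \<noteq> x")
    case True
    then obtain n where n: "\<alpha> n" "\<phi> n t \<noteq> x" by blast
    then have "\<And>m. m \<noteq> n \<Longrightarrow> \<phi> m t = x" using disj by blast
    then show ?thesis using n wedge_eq[of n \<phi> t x \<alpha>] by auto
  next
    case False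
    then show ?thesis by (auto simp: wedge_def)
  qed
  have op: "openin ?I {t \<in> topspace ?I. \<phi> n t \<in> U}" if "openin X U" for n U
    using openin_continuous_map_preimage[OF _ that] \<phi> unfolding pathin_def by blast
  have "openin ?I {t \<in> topspace ?I. wedge \<phi> x \<alpha> t \<in> U}" if U: "openin X U" for U
  proof (cases "x \<in> U")
    case True
    obtain N where N: "\<And>n t. n \<ge> N \<Longrightarrow> t \<in> {0..1} \<Longrightarrow> \<phi> n t \<in> U"
      using small[OF U True] by (metis image_subset_iff)
    \<comment> \<open>Only selected loops of index below \<open>N\<close> impose a condition; the
      whole interval is inserted in case there are none.\<close>
    let ?F = "insert (topspace ?I) ((\<lambda>n. {t \<in> topspace ?I. \<phi> n t \<in> U}) ` {n. n < N \<and> \<alpha> n})"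
    have "openin ?I (\<Inter>?F)"
      by (rule openin_Inter) (use op[OF U] in \<open>auto\<close>)
    moreover have "wedge \<phi> x \<alpha> t \<in> U \<longleftrightarrow> (\<forall>n. n < N \<and> \<alpha> n \<longrightarrow> \<phi> n t \<in> U)" if t: "t \<in> {0..1}" for t
      using wedge_cases[of t] N[OF _ t] True by (metis linorder_not_less)
    then have "{t \<in> topspace ?I. wedge \<phi> x \<alpha> t \<in> U} = \<Inter>?F" by auto
    ultimately show ?thesis by simp
  next
    case False
    have "openin ?I (\<Union>n\<in>{n. \<alpha> n}. {t \<in> topspace ?I. \<phi> n t \<in> U})"
      by (intro openin_Union) (use op[OF U] in auto)
    moreover have "wedge \<phi> x \<alpha> t \<in> U \<longleftrightarrow> (\<exists>n. \<alpha> n \<and> \<phi> n t \<in> U)" for t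
      using wedge_cases[of t] False by metis
    then have "{t \<in> topspace ?I. wedge \<phi> x \<alpha> t \<in> U} = (\<Union>n\<in>{n. \<alpha> n}. {t \<in> topspace ?I. \<phi> n t \<in> U})"
      by auto
    ultimately show ?thesis by simp
  qed
  moreover have "wedge \<phi> x \<alpha> t \<in> topspace X" if "t \<in> {0..1}" for t
  proof -
    have "\<phi> n t \<in> topspace X" for n
      using \<phi>[of n] that continuous_map_image_subset_topspace unfolding pathin_def by fastforce
    then show ?thesis using wedge_cases[of t] x by metis
  qed
  ultimately show ?thesis
    unfolding pathin_def continuous_map_def by auto
qed

text \<open>At a fixed time the value depends on at most one entry of the sequence, that of the loop
  which is away from \<open>x\<close>. The map \<open>p\<close> will be \<open>fst\<close> or
  \<open>snd\<close>.\<close>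

lemma continuous_map_wedge_param:
  fixes p :: "'b \<Rightarrow> bool"
  assumes x: "x \<in> topspace X" and "\<And>n. \<phi> n t \<in> topspace X"
    and disj: "\<And>n m. \<phi> n t \<noteq> x \<Longrightarrow> \<phi> m t \<noteq> x \<Longrightarrow> n = m"
  shows "continuous_map (seq_topology (UNIV :: 'b set)) X (\<lambda>y. wedge \<phi> x (p \<circ> y) t)"
proof (cases "\<exists>n. \<phi> n t \<noteq> x")
  case True
  then obtain n where n: "\<phi> n t \<noteq> x" by blast
  then have "\<And>m. m \<noteq> n \<Longrightarrow> \<phi> m t = x" using disj by blast
  then have eq: "wedge \<phi> x (p \<circ> y) t = (if p (y n) then \<phi> n t else x)" for y :: "nat \<Rightarrow> 'b"
    using wedge_eq[of n \<phi> t x "p \<circ> y"] by simp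
  have "continuous_map (seq_topology (UNIV :: 'b set)) X ((\<lambda>b. if p b then \<phi> n t else x) \<circ> (\<lambda>y. y n))"
    by (rule continuous_map_compose[OF continuous_map_product_projection])
      (use assms in \<open>auto simp: continuous_map_from_discrete_topology\<close>)
  moreover have "(\<lambda>y. wedge \<phi> x (p \<circ> y) t) = (\<lambda>b. if p b then \<phi> n t else x) \<circ> (\<lambda>y. y n)"
    by (rule ext) (simp only: eq comp_apply)
  ultimately show ?thesis by (simp only:)
next
  case False
  then have "wedge \<phi> x (p \<circ> y) t = x" for y :: "nat \<Rightarrow> 'b" by (intro wedge_base) blast
  then show ?thesis using x by simp
qed

lemma singular_boundary_seg_decompose:
  assumes g: "pathin X g" and ab: "a \<in> {0..1}" "b \<in> {0..1}"
  shows "singular_boundary 1 X (frag_of (seg g 0 a) + frag_of (seg g a b) + frag_of (seg g b 1) - frag_of (path_simplex g))"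
proof -
  have "singular_boundary 1 X
     ((frag_of (seg g 0 a) + frag_of (seg g a b) - frag_of (seg g 0 b)) +
      (frag_of (seg g 0 b) + frag_of (seg g b 1) - frag_of (seg g 0 1)))"
    by (intro singular_boundary_add singular_boundary_seg_triangle g ab) auto
  then show ?thesis by (simp add: seg_0_1 algebra_simps)
qed

text \<open>Cutting at \<open>a\<close> and \<open>b\<close> splits the class of a path into a sum,
  in which the common outer pieces cancel.\<close>

lemma homologous_replace_segment:
  assumes g: "pathin X g" and h: "pathin X h" and ab: "a \<in> {0..1}" "b \<in> {0..1}"
    and "seg g 0 a = seg h 0 a" "seg g b 1 = seg h b 1"
    and gh: "singular_boundary 1 X (frag_of (path_simplex g) - frag_of (path_simplex h))"
  shows "singular_boundary 1 X (frag_of (seg g a b) - frag_of (seg h a b))"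
proof -
  have "singular_boundary 1 X
    ((frag_of (seg g 0 a) + frag_of (seg g a b) + frag_of (seg g b 1) - frag_of (path_simplex g)) -
     (frag_of (seg h 0 a) + frag_of (seg h a b) + frag_of (seg h b 1) - frag_of (path_simplex h)) +
     (frag_of (path_simplex g) - frag_of (path_simplex h)))"
    by (intro singular_boundary_add singular_boundary_diff singular_boundary_seg_decompose g h ab gh)
  then show ?thesis using assms by (simp add: algebra_simps)
qed

text \<open>The loop \<open>l n\<close> is run through on \<open>[1/(n+2), 1/(n+1)]\<close>.\<close>

definition slot :: "(nat \<Rightarrow> real \<Rightarrow> 'a) \<Rightarrow> nat \<Rightarrow> real \<Rightarrow> 'a"
  where "slot l n t = l n (max 0 (min 1 ((t - 1 / (real n + 2)) * ((real n + 1) * (real n + 2)))))"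

text \<open>The interval from \<open>1/(n+2)\<close> to \<open>1/(n+1)\<close> has length
  \<open>1/((n+1)(n+2))\<close>, which explains the factor in \<open>slot\<close>.\<close>

lemma slot_rescale:
  fixes t :: real
  shows "((1 - t) * (1 / (real n + 2)) + t * (1 / (real n + 1)) - 1 / (real n + 2)) * ((real n + 1) * (real n + 2)) = t"
proof -
  define p q u v where "p = real n + 1" "q = real n + 2" "u = 1 / q" "v = 1 / p"
  have "u * (p * q) = p" "v * (p * q) = q" "q = p + 1" unfolding p_q_u_v_def by auto
  moreover have "((1 - t) * u + t * v - u) * (p * q) = (1 - t) * (u * (p * q)) + t * (v * (p * q)) - u * (p * q)"
    by (simp add: algebra_simps)
  ultimately have "((1 - t) * u + t * v - u) * (p * q) = (1 - t) * p + t * (p + 1) - p" by (simp only:)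
  then show ?thesis unfolding p_q_u_v_def by (simp add: algebra_simps)
qed

lemma slot_outside:
  assumes "l n 0 = x" "l n 1 = x" "t \<le> 1 / (real n + 2) \<or> 1 / (real n + 1) \<le> t"
  shows "slot l n t = x"
  using assms(3)
proof
  assume "t \<le> 1 / (real n + 2)"
  then have "(t - 1 / (real n + 2)) * ((real n + 1) * (real n + 2)) \<le> 0"
    by (intro mult_nonpos_nonneg) auto
  then have "max 0 (min 1 ((t - 1 / (real n + 2)) * ((real n + 1) * (real n + 2)))) = 0" by linarith
  then show ?thesis using assms(1) by (simp add: slot_def)
next
  assume t: "1 / (real n + 1) \<le> t"
  have "1 = (1 / (real n + 1) - 1 / (real n + 2)) * ((real n + 1) * (real n + 2))"
    using slot_rescale[of 1 n] by simp
  also have "\<dots> \<le> (t - 1 / (real n + 2)) * ((real n + 1) * (real n + 2))"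
    using t by (intro mult_right_mono) auto
  finally have "max 0 (min 1 ((t - 1 / (real n + 2)) * ((real n + 1) * (real n + 2)))) = 1" by linarith
  then show ?thesis using assms(2) by (simp add: slot_def)
qed

lemma slot_inside:
  assumes "t \<in> {0..1}"
  shows "slot l n ((1 - t) * (1 / (real n + 2)) + t * (1 / (real n + 1))) = l n t"
  using assms unfolding slot_def slot_rescale by simp

lemma slot_disjoint:
  assumes "\<And>n. l n 0 = x" "\<And>n. l n 1 = x" "slot l n t \<noteq> x" "slot l m t \<noteq> x"
  shows "n = m"
proof -
  have "\<not> n < m" if "slot l n t \<noteq> x" "slot l m t \<noteq> x" for n m
  proof
    assume "n < m"
    then have "1 / (real m + 1) \<le> 1 / (real n + 2)" by (intro divide_left_mono) auto
    moreover have "1 / (real n + 2) < t" "t < 1 / (real m + 1)"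
      using that slot_outside[of l n x t] slot_outside[of l m x t] assms(1,2) by force+
    ultimately show False by linarith
  qed
  then show ?thesis using assms(3,4) by (meson linorder_neqE_nat)
qed

lemma slot_image: "slot l n t \<in> l n ` {0..1}"
  by (auto simp: slot_def)

lemma pathin_slot:
  assumes "pathin X (l n)"
  shows "pathin X (slot l n)"
proof -
  have "continuous_map (subtopology euclideanreal {0..1}) (subtopology euclideanreal {0..1})
     (\<lambda>t. max 0 (min 1 ((t - 1 / (real n + 2)) * ((real n + 1) * (real n + 2)))))"
    unfolding continuous_map_in_subtopology by (auto intro!: continuous_intros)
  then have "continuous_map (subtopology euclideanreal {0..1}) X
     (l n \<circ> (\<lambda>t. max 0 (min 1 ((t - 1 / (real n + 2)) * ((real n + 1) * (real n + 2))))))"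
    using assms unfolding pathin_def by (rule continuous_map_compose)
  moreover have "slot l n = l n \<circ> (\<lambda>t. max 0 (min 1 ((t - 1 / (real n + 2)) * ((real n + 1) * (real n + 2)))))"
    by (rule ext) (simp only: slot_def comp_apply)
  ultimately show ?thesis by (simp only: pathin_def)
qed

section \<open>Continuum many classes from small essential loops\<close>

lemma bool_pair_sequences_lepoll_real:
  "(UNIV :: (nat \<Rightarrow> bool \<times> bool) set) \<lesssim> (UNIV :: real set)"
proof -
  let ?f = "\<lambda>(y :: nat \<Rightarrow> bool \<times> bool). {n. if even n then fst (y (n div 2)) else snd (y (n div 2))}"
  have "inj ?f"
  proof (rule injI)
    fix y z assume eq: "?f y = ?f z"
    have "y n = z n" for n
    proof -
      have "2 * n \<in> ?f y \<longleftrightarrow> 2 * n \<in> ?f z" "2 * n + 1 \<in> ?f y \<longleftrightarrow> 2 * n + 1 \<in> ?f z" using eq by blast+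
      then show ?thesis by (simp add: prod_eq_iff)
    qed
    then show "y = z" by blast
  qed
  then have "(UNIV :: (nat \<Rightarrow> bool \<times> bool) set) \<lesssim> (UNIV :: nat set set)"
    unfolding lepoll_def by blast
  then show ?thesis using nat_sets_eqpoll_reals lepoll_trans2 by blast
qed

lemma real_lepoll_bool_sequences: "(UNIV :: real set) \<lesssim> (UNIV :: (nat \<Rightarrow> bool) set)"
proof -
  have "inj (\<lambda>(S :: nat set) n. n \<in> S)" by (auto intro!: injI simp: fun_eq_iff)
  then have "(UNIV :: nat set set) \<lesssim> (UNIV :: (nat \<Rightarrow> bool) set)" unfolding lepoll_def by blast
  then show ?thesis using nat_sets_eqpoll_reals eqpoll_sym lepoll_trans1 by blast
qed

lemma small_essential_loops_continuum:
  fixes K :: "'k set" and X :: "'a topology"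
  assumes K: "infinite K" and BP: "BP K" and X: "kappa_polish K X" and x: "x \<in> topspace X"
    and loops: "\<And>U. openin X U \<Longrightarrow> x \<in> U \<Longrightarrow> \<exists>g. pathin X g \<and> g ` {0..1} \<subseteq> U \<and> g 0 = x \<and> g 1 = x \<and>
       \<not> singular_boundary 1 X (frag_of (path_simplex g))"
  shows "(UNIV :: real set) \<lesssim> carrier (homology_group 1 X)"
proof -
  obtain M d where "Metric_space M d" and X_eq: "X = Metric_space.mtopology M d"
    using X unfolding kappa_polish_def completely_metrizable_space_def by blast
  then interpret Metric_space M d by simp
  have "\<exists>g. pathin X g \<and> g ` {0..1} \<subseteq> mball x ((1/2)^n) \<and> g 0 = x \<and> g 1 = x \<and>
       \<not> singular_boundary 1 X (frag_of (path_simplex g))" for n :: nat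
    by (rule loops) (use x in \<open>simp_all add: X_eq\<close>)
  then obtain l where l: "\<And>n. pathin X (l n)" "\<And>n. l n ` {0..1} \<subseteq> mball x ((1/2)^n)"
    "\<And>n. l n 0 = x" "\<And>n. l n 1 = x"
    "\<And>n. \<not> singular_boundary 1 X (frag_of (path_simplex (l n)))"
    by metis
  have small: "\<exists>N. \<forall>n\<ge>N. slot l n ` {0..1} \<subseteq> U" if U: "openin X U" "x \<in> U" for U
  proof -
    obtain r where r: "r > 0" "mball x r \<subseteq> U"
      using U unfolding X_eq openin_mtopology by blast
    obtain N where N: "(1/2::real)^N < r" using real_arch_pow_inv[OF r(1), of "1/2"] by auto
    have "slot l n t \<in> U" if "n \<ge> N" for n t
    proof -
      have "(1/2::real)^n \<le> (1/2)^N" using that by (intro power_decreasing) auto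
      then have "mball x ((1/2)^n) \<subseteq> mball x r" using N by (intro mball_subset_concentric) linarith
      then show ?thesis using slot_image[of l n t] l(2)[of n] r(2) by blast
    qed
    then show ?thesis by blast
  qed
  note disj = slot_disjoint[of l, OF l(3,4)]
  let ?L = "wedge (slot l) x"
  have path: "pathin X (?L \<alpha>)" for \<alpha>
    by (rule pathin_wedge[OF x pathin_slot[OF l(1)] _ small]) (rule disj)
  have loop: "?L \<alpha> 0 = ?L \<alpha> 1" for \<alpha>
  proof -
    have "?L \<alpha> 0 = x" by (rule wedge_base, rule slot_outside) (simp_all add: l)
    moreover have "?L \<alpha> 1 = x" by (rule wedge_base, rule slot_outside) (simp_all add: l)
    ultimately show ?thesis by simp
  qed
  let ?R = "\<lambda>\<alpha> \<beta>. singular_boundary 1 X (frag_of (path_simplex (?L \<alpha>)) - frag_of (path_simplex (?L \<beta>)))"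
  have sym: "?R \<beta> \<alpha>" if "?R \<alpha> \<beta>" for \<alpha> \<beta>
    using that by (rule singular_boundary_minus_commute)
  \<comment> \<open>Outside the slot of \<open>n\<close> the two concatenations agree, so their
    outer segments are identical simplices. On the slot, \<open>l n\<close> is compared with a
    constant path, itself a boundary; hence \<open>l n\<close> would be a boundary too.\<close>
  have flip1: "\<not> ?R \<alpha> \<beta>" if \<alpha>: "\<alpha> n" "\<not> \<beta> n" "\<And>m. m \<noteq> n \<Longrightarrow> \<alpha> m = \<beta> m" for \<alpha> \<beta> n
  proof
    assume R: "?R \<alpha> \<beta>"
    let ?a = "1 / (real n + 2)" and ?b = "1 / (real n + 1)"
    have ab: "?a \<in> {0..1}" "?b \<in> {0..1}" by auto
    have "?a \<le> ?b" by (intro divide_left_mono) auto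
    have agree: "?L \<alpha> t = ?L \<beta> t" if "t \<le> ?a \<or> ?b \<le> t" for t
      by (rule wedge_cong) (use \<alpha>(3) slot_outside[of l n x t, OF l(3,4) that] in metis)
    have "seg (?L \<alpha>) 0 ?a = seg (?L \<beta>) 0 ?a"
      unfolding seg_def
      by (intro path_simplex_cong agree disjI1) (auto intro!: divide_right_mono)
    moreover have "seg (?L \<alpha>) ?b 1 = seg (?L \<beta>) ?b 1"
      unfolding seg_def
    proof (intro path_simplex_cong agree disjI2)
      fix t :: real assume t: "t \<in> {0..1}"
      have "t * ?b \<le> t * 1" using t by (intro mult_left_mono) auto
      moreover have "(1 - t) * ?b + t * 1 = ?b - t * ?b + t * 1" by (simp only: left_diff_distrib mult_1)
      ultimately show "?b \<le> (1 - t) * ?b + t * 1" by linarith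
    qed
    ultimately have "singular_boundary 1 X (frag_of (seg (?L \<alpha>) ?a ?b) - frag_of (seg (?L \<beta>) ?a ?b))"
      by (rule homologous_replace_segment[OF path path ab _ _ R])
    moreover have mid: "?L \<gamma> ((1 - t) * ?a + t * ?b) = (if \<gamma> n then l n t else x)" if t: "t \<in> {0..1}" for \<gamma> t
    proof -
      have other: "slot l m ((1 - t) * ?a + t * ?b) = x" if "m \<noteq> n" for m
      proof (rule slot_outside[OF l(3,4)])
        let ?s = "(1 - t) * ?a + t * ?b"
        \<comment> \<open>The lower bound is the upper bound for the negated numbers.\<close>
        have s: "?a \<le> ?s" "?s \<le> ?b"
          using convex_bound_le[of "- ?a" "- ?a" "- ?b" "1 - t" t] convex_bound_le[of ?a ?b ?b "1 - t" t]
            t \<open>?a \<le> ?b\<close> by auto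
        show "?s \<le> 1 / (real m + 2) \<or> 1 / (real m + 1) \<le> ?s"
        proof (cases "m < n")
          case True
          then have "?b \<le> 1 / (real m + 2)" by (intro divide_left_mono) auto
          then show ?thesis using s by linarith
        next
          case False
          then have "1 / (real m + 1) \<le> ?a" using that by (intro divide_left_mono) auto
          then show ?thesis using s by linarith
        qed
      qed
      show ?thesis using wedge_eq[of n "slot l" _ x \<gamma>, OF other] slot_inside[OF t, of l n] by simp
    qed
    have "seg (?L \<alpha>) ?a ?b = path_simplex (l n)"
      unfolding seg_def by (intro path_simplex_cong) (simp only: mid \<alpha>(1) if_True)
    moreover have "seg (?L \<beta>) ?a ?b = path_simplex (\<lambda>_. x)"
      unfolding seg_def by (intro path_simplex_cong) (simp only: mid \<alpha>(2) if_False)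
    ultimately have "singular_boundary 1 X (frag_of (path_simplex (l n)) - frag_of (path_simplex (\<lambda>_. x)))"
      by simp
    moreover have "singular_boundary 1 X (frag_of (path_simplex (\<lambda>_. x)))"
      using singular_boundary_seg_same[of X "\<lambda>_. x" 0] x by (simp add: seg_same pathin_const)
    ultimately have "singular_boundary 1 X (frag_of (path_simplex (l n)))"
      using singular_boundary_add by fastforce
    then show False using l(5) by blast
  qed
  have "\<exists>u :: (nat \<Rightarrow> bool) \<Rightarrow> nat \<Rightarrow> bool. \<forall>\<alpha> \<beta>. \<alpha> \<noteq> \<beta> \<longrightarrow> \<not> ?R (u \<alpha>) (u \<beta>)"
  proof (rule baire_equivalence_continuum_classes[of ?R])
    show "?R \<alpha> \<gamma>" if "?R \<alpha> \<beta>" "?R \<beta> \<gamma>" for \<alpha> \<beta> \<gamma>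
      using singular_boundary_add[OF that] by simp
    show "\<not> ?R \<alpha> (\<alpha>(n := \<not> \<alpha> n))" for \<alpha> n
    proof (cases "\<alpha> n")
      case True
      then show ?thesis by (intro flip1[of _ n]) auto
    next
      case False
      then have "\<not> ?R (\<alpha>(n := \<not> \<alpha> n)) \<alpha>" by (intro flip1[of _ n]) auto
      then show ?thesis using sym by blast
    qed
    \<comment> \<open>A pair of sequences is read off one sequence of pairs, so the relation becomes
      a subset of a single sequence space.\<close>
    let ?C = "seq_topology (UNIV :: (bool \<times> bool) set)"
    have slotX: "slot l n t \<in> topspace X" for n t
      using slot_image[of l n t] l(2)[of n] by (auto simp: X_eq)
    have param: "continuous_map ?C X (\<lambda>y. ?L (p \<circ> y) t)" for p t
    proof (rule continuous_map_wedge_param[OF x])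
      show "slot l n t \<in> topspace X" for n by (rule slotX)
      show "n = m" if "slot l n t \<noteq> x" "slot l m t \<noteq> x" for n m using that by (rule disj)
    qed
    have "kappa_suslin K ?C {y \<in> topspace ?C. ?R (fst \<circ> y) (snd \<circ> y)}"
    proof (rule kappa_suslin_homologous[OF K X])
      show "topspace X \<noteq> {}" using x by blast
    qed (rule param)+
    moreover have top: "topspace ?C = UNIV" unfolding topspace_seq_topology by simp
    ultimately have suslin: "kappa_suslin K ?C {y. ?R (fst \<circ> y) (snd \<circ> y)}"
      by (simp only: UNIV_I simp_thms)
    show "baire_property ?C {y. ?R (fst \<circ> y) (snd \<circ> y)}"
      by (rule BP_baire_property[OF BP polish_space_seq_topology _ suslin])
        (simp_all only: top bool_pair_sequences_lepoll_real subset_UNIV)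
  next
    fix u :: "(nat \<Rightarrow> bool) \<Rightarrow> nat \<Rightarrow> bool" assume "\<And>\<alpha> \<beta>. \<alpha> \<noteq> \<beta> \<Longrightarrow> \<not> ?R (u \<alpha>) (u \<beta>)"
    then show "\<exists>u :: (nat \<Rightarrow> bool) \<Rightarrow> nat \<Rightarrow> bool. \<forall>\<alpha> \<beta>. \<alpha> \<noteq> \<beta> \<longrightarrow> \<not> ?R (u \<alpha>) (u \<beta>)"
      by (intro exI[of _ u] allI impI)
  qed (rule sym)
  then obtain u :: "(nat \<Rightarrow> bool) \<Rightarrow> nat \<Rightarrow> bool"
    where u: "\<And>\<alpha> \<beta>. \<alpha> \<noteq> \<beta> \<Longrightarrow> \<not> ?R (u \<alpha>) (u \<beta>)" by blast
  have "(UNIV :: (nat \<Rightarrow> bool) set) \<lesssim> carrier (homology_group 1 X)"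
    by (rule lepoll_homology_group[of _ 1 X "\<lambda>\<alpha>. frag_of (path_simplex (?L (u \<alpha>)))"])
      (use u singular_cycle_path_simplex[OF path loop] in blast)+
  then show ?thesis using real_lepoll_bool_sequences lepoll_trans by blast
qed

section \<open>Small loops and the number of homology classes\<close>

definition path_between :: "'a topology \<Rightarrow> 'a set \<Rightarrow> (real \<Rightarrow> 'a) \<Rightarrow> 'a \<Rightarrow> 'a \<Rightarrow> bool"
  where "path_between X U g x y \<longleftrightarrow> pathin X g \<and> g ` {0..1} \<subseteq> U \<and> g 0 = x \<and> g 1 = y"

abbreviation path_chain :: "(real \<Rightarrow> 'a) \<Rightarrow> 'a chain"
  where "path_chain g \<equiv> frag_of (path_simplex g)"

lemma path_between_mono: "path_between X U g x y \<Longrightarrow> U \<subseteq> V \<Longrightarrow> path_between X V g x y"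
  unfolding path_between_def by blast

lemma path_connectedin_path_between:
  assumes "path_connectedin X U" "x \<in> U" "y \<in> U"
  obtains g where "path_between X U g x y"
proof -
  obtain g where "pathin X g" "g \<in> {0..1} \<rightarrow> U" "g 0 = x" "g 1 = y"
    using assms unfolding path_connectedin by metis
  then have "path_between X U g x y" unfolding path_between_def by auto
  then show thesis by (rule that)
qed

text \<open>Going forth and back is the degenerate triangle with vertices 0, 1, 0, up to a constant
  path.\<close>

lemma path_between_reverse:
  assumes p: "path_between X U p x y"
  obtains r where "path_between X U r y x" "singular_boundary 1 X (path_chain p + path_chain r)"
proof
  have path: "pathin X p" using p unfolding path_between_def by blast
  have r: "(\<lambda>t. p ((1 - t) * 1 + t * 0)) = (\<lambda>t. p (1 - t))" by simp
  have "pathin X (\<lambda>t. p (1 - t))" using pathin_seg[OF path, of 1 0] unfolding r by simp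
  then show "path_between X U (\<lambda>t. p (1 - t)) y x" using p unfolding path_between_def by auto
  have "singular_boundary 1 X ((frag_of (seg p 0 1) + frag_of (seg p 1 0) - frag_of (seg p 0 0)) + frag_of (seg p 0 0))"
    by (intro singular_boundary_add singular_boundary_seg_triangle singular_boundary_seg_same path) auto
  then show "singular_boundary 1 X (path_chain p + path_chain (\<lambda>t. p (1 - t)))"
    by (simp add: seg_0_1) (simp add: seg_def)
qed

text \<open>The triangle with vertices 0, 1/2, 1 on the concatenation makes it homologous to the
  sum. Staying within \<open>U\<close> is recorded because loops are controlled only there.\<close>

lemma path_between_join:
  assumes p: "path_between X U p x y" and q: "path_between X U q y z"
  obtains g where "path_between X U g x z" "singular_boundary 1 X (path_chain p + path_chain q - path_chain g)"
proof
  let ?I = "subtopology euclideanreal {0..1}"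
  define g where "g t = (if t \<le> 1/2 then p (2 * t) else q (2 * t - 1))" for t :: real
  have pq: "pathin X p" "pathin X q" "p 1 = y" "q 0 = y"
    using p q unfolding path_between_def by auto
  have "continuous_map ?I X (\<lambda>t. if t \<le> 1/2 then (p \<circ> (\<lambda>t. 2 * t)) t else (q \<circ> (\<lambda>t. 2 * t - 1)) t)"
  proof (rule continuous_map_cases_le)
    show "continuous_map (subtopology ?I {t \<in> topspace ?I. t \<le> 1/2}) X (p \<circ> (\<lambda>t. 2 * t))"
    proof (rule continuous_map_compose)
      show "continuous_map (subtopology ?I {t \<in> topspace ?I. t \<le> 1/2}) ?I (\<lambda>t. 2 * t)"
        unfolding continuous_map_in_subtopology subtopology_subtopology by (auto intro!: continuous_intros)
    qed (use pq in \<open>simp add: pathin_def\<close>)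
    show "continuous_map (subtopology ?I {t \<in> topspace ?I. 1/2 \<le> t}) X (q \<circ> (\<lambda>t. 2 * t - 1))"
    proof (rule continuous_map_compose)
      show "continuous_map (subtopology ?I {t \<in> topspace ?I. 1/2 \<le> t}) ?I (\<lambda>t. 2 * t - 1)"
        unfolding continuous_map_in_subtopology subtopology_subtopology by (auto intro!: continuous_intros)
    qed (use pq in \<open>simp add: pathin_def\<close>)
    fix t :: real assume "t = 1/2"
    then have "2 * t = 1" by simp
    then show "(p \<circ> (\<lambda>t. 2 * t)) t = (q \<circ> (\<lambda>t. 2 * t - 1)) t" using pq by simp
  qed auto
  then have path: "pathin X g" unfolding pathin_def g_def comp_def .
  have "g t \<in> U" if "t \<in> {0..1}" for t
  proof (cases "t \<le> 1/2")
    case True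
    then have "2 * t \<in> {0..1}" using that by auto
    then show ?thesis using p True unfolding path_between_def g_def by auto
  next
    case False
    then have "2 * t - 1 \<in> {0..1}" using that by auto
    then show ?thesis using q False unfolding path_between_def g_def by auto
  qed
  then show "path_between X U g x z"
    using path p q unfolding path_between_def by (auto simp: g_def)
  have "seg g 0 (1/2) = path_simplex p"
    unfolding seg_def by (rule path_simplex_cong) (auto simp: g_def)
  moreover have "seg g (1/2) 1 = path_simplex q"
    unfolding seg_def
  proof (rule path_simplex_cong)
    fix t :: real assume t: "t \<in> {0..1}"
    have e: "(1 - t) * (1/2) + t * 1 = 1/2 + t/2" by (simp add: field_simps)
    \<comment> \<open>At \<open>t = 0\<close> the first branch of \<open>g\<close> applies; its
      value is the common end point.\<close>
    show "g ((1 - t) * (1/2) + t * 1) = q t"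
      unfolding e using t pq by (cases "t = 0") (auto simp: g_def)
  qed
  ultimately show "singular_boundary 1 X (path_chain p + path_chain q - path_chain g)"
    using singular_boundary_seg_triangle[OF path, of 0 "1/2" 1] by (simp add: seg_0_1)
qed

section \<open>Sets whose loops bound in the whole space\<close>

text \<open>The loops lie in \<open>U\<close>, but the 2-chains they bound may use all of
  \<open>X\<close>; this is why the property passes to subsets.\<close>

definition null_loops :: "'a topology \<Rightarrow> 'a set \<Rightarrow> bool"
  where "null_loops X U \<longleftrightarrow> (\<forall>g x. path_between X U g x x \<longrightarrow> singular_boundary 1 X (path_chain g))"

lemma null_loops_subset: "null_loops X U \<Longrightarrow> V \<subseteq> U \<Longrightarrow> null_loops X V"
  unfolding null_loops_def using path_between_mono by metis

text \<open>Following \<open>p\<close> and then \<open>q\<close> backwards is a loop in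
  \<open>U\<close>. So within \<open>U\<close> a path matters, up to homology, only through its
  ends.\<close>

lemma null_loops_same_ends:
  assumes U: "null_loops X U" and p: "path_between X U p x y" and q: "path_between X U q x y"
  shows "singular_boundary 1 X (path_chain p - path_chain q)"
proof -
  obtain r where r: "path_between X U r y x" "singular_boundary 1 X (path_chain q + path_chain r)"
    using path_between_reverse[OF q] .
  obtain g where g: "path_between X U g x x" "singular_boundary 1 X (path_chain p + path_chain r - path_chain g)"
    using path_between_join[OF p r(1)] .
  have "singular_boundary 1 X (path_chain g)" using U g(1) unfolding null_loops_def by blast
  then have "singular_boundary 1 X ((path_chain p + path_chain r - path_chain g) + path_chain g - (path_chain q + path_chain r))"
    by (intro singular_boundary_diff singular_boundary_add g(2) r(2))
  then show ?thesis by (simp add: algebra_simps)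
qed

lemma null_loops_triangle:
  assumes U: "null_loops X U" and p: "path_between X U p x y" and q: "path_between X U q y z"
    and r: "path_between X U r x z"
  shows "singular_boundary 1 X (path_chain p + path_chain q - path_chain r)"
proof -
  obtain g where g: "path_between X U g x z" "singular_boundary 1 X (path_chain p + path_chain q - path_chain g)"
    using path_between_join[OF p q] .
  have "singular_boundary 1 X ((path_chain p + path_chain q - path_chain g) + (path_chain g - path_chain r))"
    by (intro singular_boundary_add g(2) null_loops_same_ends[OF U g(1) r])
  then show ?thesis by simp
qed

text \<open>Conjugating a loop by a path to its base point does not change its homology class, since
  that path is run through once in each direction.\<close>

lemma essential_loop_at_base:
  assumes "path_connectedin X U" "x \<in> U" "\<not> null_loops X U"
  obtains g where "path_between X U g x x" "\<not> singular_boundary 1 X (path_chain g)"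
proof -
  obtain l y where l: "path_between X U l y y" "\<not> singular_boundary 1 X (path_chain l)"
    using assms(3) unfolding null_loops_def by blast
  have "y \<in> U" using l(1) unfolding path_between_def by force
  then obtain p where p: "path_between X U p x y" using path_connectedin_path_between assms by metis
  obtain r where r: "path_between X U r y x" "singular_boundary 1 X (path_chain p + path_chain r)"
    using path_between_reverse[OF p] .
  obtain q where q: "path_between X U q x y" "singular_boundary 1 X (path_chain p + path_chain l - path_chain q)"
    using path_between_join[OF p l(1)] .
  obtain g where g: "path_between X U g x x" "singular_boundary 1 X (path_chain q + path_chain r - path_chain g)"
    using path_between_join[OF q(1) r(1)] .
  have "\<not> singular_boundary 1 X (path_chain g)"
  proof
    assume "singular_boundary 1 X (path_chain g)"
    then have "singular_boundary 1 X ((path_chain p + path_chain l - path_chain q) +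
        (path_chain q + path_chain r - path_chain g) + path_chain g - (path_chain p + path_chain r))"
      by (intro singular_boundary_diff singular_boundary_add q(2) g(2) r(2))
    then show False using l(2) by (simp add: algebra_simps)
  qed
  then show thesis using that g(1) by blast
qed

section \<open>Upper bounds for the homology group\<close>

lemma free_Abelian_group_lepoll:
  fixes A :: "'a set" and K :: "'k set"
  assumes "infinite K" "A \<lesssim> K"
  shows "carrier (free_Abelian_group A) \<lesssim> K"
proof -
  have "carrier (free_Abelian_group A) \<lesssim> {f :: 'a \<Rightarrow> int. f ` A \<subseteq> UNIV \<and> {x. f x \<noteq> 0} \<subseteq> A \<and> finite {x. f x \<noteq> 0}}"
    unfolding lepoll_def
    by (rule exI[of _ Poly_Mapping.lookup]) (auto simp: poly_mapping_eqI lookup_not_eq_zero_eq_in_keys inj_onI)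
  also have "\<dots> \<lesssim> Fpow (A \<times> (UNIV :: int set))"
    by (rule lepoll_restricted_funspace)
  also have "\<dots> \<lesssim> K"
    by (intro Fpow_lepoll_infinite times_lepoll_infinite countable_lepoll_infinite assms) simp
  finally show ?thesis .
qed

lemma real_sequences_lepoll_real: "(UNIV :: (nat \<Rightarrow> real) set) \<lesssim> (UNIV :: real set)"
proof -
  obtain h :: "real \<Rightarrow> nat set" where h: "inj h"
    using nat_sets_eqpoll_reals eqpoll_sym eqpoll_imp_lepoll unfolding lepoll_def by blast
  let ?f = "\<lambda>(c :: nat \<Rightarrow> real). {j. snd (prod_decode j) \<in> h (c (fst (prod_decode j)))}"
  have "inj ?f"
  proof (rule injI)
    fix b c assume eq: "?f b = ?f c"
    have "h (b n) = h (c n)" for n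
    proof (intro equalityI subsetI)
      fix k
      have "prod_encode (n, k) \<in> ?f b \<longleftrightarrow> prod_encode (n, k) \<in> ?f c" using eq by blast
      then have *: "k \<in> h (b n) \<longleftrightarrow> k \<in> h (c n)" by simp
      show "k \<in> h (c n)" if "k \<in> h (b n)" using * that by blast
      show "k \<in> h (b n)" if "k \<in> h (c n)" using * that by blast
    qed
    then show "b = c" using h by (auto simp: inj_def)
  qed
  then have "(UNIV :: (nat \<Rightarrow> real) set) \<lesssim> (UNIV :: nat set set)" unfolding lepoll_def by blast
  then show ?thesis using nat_sets_eqpoll_reals lepoll_trans2 by blast
qed

text \<open>Every 1-simplex is coded by a \<open>K\<close>-sequence, and these inject into the
  sequences of reals; so even the group of all 1-chains has at most continuum many elements.\<close>

lemma homology_group_1_lepoll_real: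
  fixes K :: "'k set" and X :: "'a topology"
  assumes K: "infinite K" "K \<lesssim> (UNIV :: real set)" and X: "kappa_polish K X"
  shows "carrier (homology_group 1 X) \<lesssim> (UNIV :: real set)"
proof -
  have "Collect (singular_simplex 1 X) \<lesssim> (UNIV :: real set)"
  proof (cases "topspace X = {}")
    case True
    have "\<not> singular_simplex 1 X f" for f
    proof
      assume "singular_simplex 1 X f"
      then obtain g where "pathin X g" using singular_simplex_1_path by metis
      then have "g 0 \<in> topspace X"
        using continuous_map_image_subset_topspace unfolding pathin_def by fastforce
      then show False using True by blast
    qed
    then show ?thesis by (simp only: Collect_empty_eq[THEN iffD2] simp_thms empty_lepoll)
  next
    case False
    obtain s :: "(nat \<Rightarrow> 'k) \<Rightarrow> (nat \<Rightarrow> real) \<Rightarrow> 'a" where s: "\<And>f. singular_simplex 1 X f \<Longrightarrow> \<exists>c. range c \<subseteq> K \<and> s c = f"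
      using continuous_maps_seq_surjection[OF K(1) compact_space_simplex_topology second_countable_simplex_topology X False]
      unfolding singular_simplex_iff by metis
    obtain h :: "'k \<Rightarrow> real" where h: "inj_on h K" using K(2) unfolding lepoll_def by blast
    have "Collect (singular_simplex 1 X) \<lesssim> {c :: nat \<Rightarrow> 'k. range c \<subseteq> K}"
      by (rule subset_image_lepoll[of _ s]) (use s in force)
    also have "\<dots> \<lesssim> (UNIV :: (nat \<Rightarrow> real) set)"
      unfolding lepoll_def
    proof (intro exI conjI inj_onI)
      fix b c assume b: "b \<in> {c :: nat \<Rightarrow> 'k. range c \<subseteq> K}" and c: "c \<in> {c :: nat \<Rightarrow> 'k. range c \<subseteq> K}"
        and eq: "h \<circ> b = h \<circ> c"
      have "b n = c n" for n
      proof (rule inj_onD[OF h])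
        show "h (b n) = h (c n)" using eq by (metis comp_apply)
      qed (use b c in auto)
      then show "b = c" by blast
    qed simp
    also have "\<dots> \<lesssim> (UNIV :: real set)" by (rule real_sequences_lepoll_real)
    finally show ?thesis .
  qed
  then have "carrier (free_Abelian_group (Collect (singular_simplex 1 X))) \<lesssim> (UNIV :: real set)"
    by (rule free_Abelian_group_lepoll[rotated]) (rule infinite_UNIV_char_0)
  moreover have "carrier (homology_group 1 X) \<lesssim> carrier (free_Abelian_group (Collect (singular_simplex 1 X)))"
  proof (rule homology_group_lepoll[where R = "(=)"])
    show "\<exists>s\<in>carrier (free_Abelian_group (Collect (singular_simplex 1 X))). s = c" if "singular_cycle 1 X c" for c
      using that unfolding singular_cycle_def singular_chain_def by simp
    show "singular_boundary 1 X (a - b)" if "s = a" "s = b" for s a b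
      using that singular_boundary_0 by simp
  qed
  ultimately show ?thesis using lepoll_trans by blast
qed

text \<open>Every point \<open>x\<close> gets one fixed tail \<open>h x\<close> into the dense set
  \<open>D\<close>. Corrected by the tails at its ends, any path lies in the group \<open>G\<close>
  of chains homologous to combinations of chosen arcs; the corrections of adjacent pieces cancel,
  and for a cycle nothing remains of them.\<close>

lemma homology_group_1_lepoll_small_loops:
  fixes K :: "'k set" and X :: "'a topology"
  assumes K: "infinite K" and X: "kappa_polish K X" and lpc: "locally_path_connected_space X"
    and good: "\<And>x. x \<in> topspace X \<Longrightarrow> \<exists>U. openin X U \<and> x \<in> U \<and> null_loops X U"
  shows "carrier (homology_group 1 X) \<lesssim> K"
proof -
  obtain M d where "Metric_space M d" and X_eq: "X = Metric_space.mtopology M d"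
    using X unfolding kappa_polish_def completely_metrizable_space_def by blast
  then interpret Metric_space M d by simp
  obtain D where D: "D \<subseteq> M" "mtopology closure_of D = M" "D \<lesssim> K"
    using X unfolding kappa_polish_def kappa_separable_def X_eq by auto
  have near: "\<exists>q\<in>D. d x q < r" if "x \<in> M" "r > 0" for x r
  proof -
    have "x \<in> mtopology closure_of D" using D(2) that by simp
    then have "\<forall>r>0. \<exists>q\<in>D. q \<in> mball x r" unfolding metric_closure_of by simp
    then show ?thesis using that by auto
  qed
  have dense: "\<exists>q\<in>D. q \<in> U" if "openin X U" "x \<in> U" for U x
  proof -
    obtain r where r: "r > 0" "mball x r \<subseteq> U" using \<open>openin X U\<close> \<open>x \<in> U\<close> unfolding X_eq openin_mtopology by blast
    have "x \<in> M" using openin_subset[OF \<open>openin X U\<close>] \<open>x \<in> U\<close> X_eq by auto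
    then obtain q where "q \<in> D" "d x q < r" using near r(1) by blast
    then have "q \<in> mball x r" using D(1) \<open>x \<in> M\<close> by auto
    then show ?thesis using r(2) \<open>q \<in> D\<close> by blast
  qed
  define nice where "nice U \<longleftrightarrow> openin X U \<and> path_connectedin X U \<and> null_loops X U" for U
  have ex_nice: "\<exists>U. nice U \<and> x \<in> U" if x: "x \<in> topspace X" for x
  proof -
    obtain U where U: "openin X U" "x \<in> U" "null_loops X U" using good[OF x] by blast
    then obtain W where "openin X W" "path_connectedin X W" "x \<in> W" "W \<subseteq> U"
      using lpc unfolding locally_path_connected_space by metis
    then show ?thesis using null_loops_subset[OF U(3)] unfolding nice_def by blast
  qed
  \<comment> \<open>Nice sets are indexed by balls with centre in \<open>D\<close> and radius
    \<open>(1/2)^n\<close>, one for each ball that fits into some nice set. This leaves at most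
    \<open>K\<close> of them.\<close>
  define I where "I = {i \<in> D \<times> (UNIV :: nat set). \<exists>U. nice U \<and> mball (fst i) ((1/2)^snd i) \<subseteq> U}"
  have "\<forall>i\<in>I. \<exists>U. nice U \<and> mball (fst i) ((1/2)^snd i) \<subseteq> U" unfolding I_def by blast
  then obtain V where V: "\<And>i. i \<in> I \<Longrightarrow> nice (V i) \<and> mball (fst i) ((1/2)^snd i) \<subseteq> V i" by metis
  have cover: "\<exists>i\<in>I. x \<in> V i" if x: "x \<in> topspace X" for x
  proof -
    obtain U where U: "nice U" "x \<in> U" using ex_nice[OF x] by blast
    have xM: "x \<in> M" using x X_eq by simp
    obtain r where r: "r > 0" "mball x r \<subseteq> U"
      using U unfolding nice_def X_eq openin_mtopology by blast
    \<comment> \<open>Half of \<open>r\<close>, because the ball around \<open>q\<close> must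
      contain \<open>x\<close> and still lie in the ball of radius \<open>r\<close> around
      \<open>x\<close>.\<close>
    obtain n where n: "(1/2::real)^n < r/2" using real_arch_pow_inv[of "r/2" "1/2"] r(1) by auto
    obtain q where q: "q \<in> D" "d x q < (1/2)^n" using near[OF xM, of "(1/2)^n"] by auto
    have "mball q ((1/2)^n) \<subseteq> mball x r"
      by (rule mball_subset) (use q n xM in \<open>auto simp: commute\<close>)
    then have "(q, n) \<in> I" unfolding I_def using q(1) U(1) r(2) by auto
    moreover have "x \<in> mball q ((1/2)^n)" using q D(1) xM commute by auto
    ultimately show ?thesis using V by fastforce
  qed
  define T where "T = (SIGMA i:I. (D \<inter> V i) \<times> (D \<inter> V i))"
  have "\<forall>t\<in>T. \<exists>g. path_between X (V (fst t)) g (fst (snd t)) (snd (snd t))"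
  proof
    fix t assume "t \<in> T"
    then have "path_connectedin X (V (fst t))" "fst (snd t) \<in> V (fst t)" "snd (snd t) \<in> V (fst t)"
      using V unfolding T_def nice_def by auto
    then show "\<exists>g. path_between X (V (fst t)) g (fst (snd t)) (snd (snd t))"
      using path_connectedin_path_between by metis
  qed
  then obtain \<gamma> where \<gamma>: "\<And>t. t \<in> T \<Longrightarrow> path_between X (V (fst t)) (\<gamma> t) (fst (snd t)) (snd (snd t))" by metis
  \<comment> \<open>\<open>\<Gamma> s\<close> is the combination of chosen arcs with coefficients
    \<open>s\<close>. \<open>G\<close> admits arbitrary chains, not only cycles, so that single
    pieces of a path can be treated.\<close>
  define \<Gamma> where "\<Gamma> = frag_extend (\<lambda>t. path_chain (\<gamma> t))"
  define G where "G = {c. \<exists>s. Poly_Mapping.keys s \<subseteq> T \<and> singular_boundary 1 X (c - \<Gamma> s)}"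
  have G_bd: "c \<in> G" if "singular_boundary 1 X c" for c
    unfolding G_def using that by (intro CollectI exI[of _ 0]) (simp add: \<Gamma>_def)
  have G_\<gamma>: "path_chain (\<gamma> t) \<in> G" if "t \<in> T" for t
    unfolding G_def using that singular_boundary_0
    by (intro CollectI exI[of _ "frag_of t"]) (simp add: \<Gamma>_def)
  have G_diff: "a - b \<in> G" if ab: "a \<in> G" "b \<in> G" for a b
  proof -
    obtain s t where s: "Poly_Mapping.keys s \<subseteq> T" "singular_boundary 1 X (a - \<Gamma> s)"
      and t: "Poly_Mapping.keys t \<subseteq> T" "singular_boundary 1 X (b - \<Gamma> t)"
      using ab unfolding G_def by blast
    have "Poly_Mapping.keys (s - t) \<subseteq> T" using s(1) t(1) keys_diff[of s t] by blast
    moreover have "singular_boundary 1 X (a - b - \<Gamma> (s - t))"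
      using singular_boundary_diff[OF s(2) t(2)] by (simp add: \<Gamma>_def frag_extend_diff algebra_simps)
    ultimately show ?thesis unfolding G_def by blast
  qed
  have G_add: "a + b \<in> G" if ab: "a \<in> G" "b \<in> G" for a b
  proof -
    have "- b \<in> G" using G_diff[OF G_bd[OF singular_boundary_0] ab(2)] by simp
    then show ?thesis using G_diff[OF ab(1)] by fastforce
  qed
  have "\<forall>x\<in>topspace X. \<exists>j q h. j \<in> I \<and> x \<in> V j \<and> q \<in> D \<inter> V j \<and> path_between X (V j) h x q"
  proof
    fix x assume "x \<in> topspace X"
    then obtain j where j: "j \<in> I" "x \<in> V j" using cover by blast
    then obtain q where q: "q \<in> D" "q \<in> V j" using dense V unfolding nice_def by metis
    obtain h where "path_between X (V j) h x q"
      using path_connectedin_path_between j q(2) V unfolding nice_def by metis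
    then show "\<exists>j q h. j \<in> I \<and> x \<in> V j \<and> q \<in> D \<inter> V j \<and> path_between X (V j) h x q"
      using j q by blast
  qed
  then obtain j q h where jqh: "\<And>x. x \<in> topspace X \<Longrightarrow>
      j x \<in> I \<and> x \<in> V (j x) \<and> q x \<in> D \<inter> V (j x) \<and> path_between X (V (j x)) (h x) x (q x)" by metis
  \<comment> \<open>The tail \<open>h x\<close> runs in \<open>V (j x)\<close>, but \<open>x\<close>
    may be met inside another nice set \<open>V i\<close>. A short path \<open>k\<close> to a dense
    point, taken in a path-connected neighbourhood within both, can replace it: in
    \<open>V (j x)\<close> it closes a triangle with \<open>h x\<close> and a chosen arc.\<close>
  have tail: "\<exists>e\<in>D \<inter> V i. \<exists>k. path_between X (V i) k x e \<and> path_chain k - path_chain (h x) \<in> G"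
    if i: "i \<in> I" "x \<in> V i" for i x
  proof -
    have op: "openin X (V i)" using V[OF i(1)] unfolding nice_def by blast
    then have x: "x \<in> topspace X" using openin_subset i(2) by blast
    note J = jqh[OF x]
    have opj: "openin X (V (j x))" and nul: "null_loops X (V (j x))"
      using V[of "j x"] J unfolding nice_def by blast+
    have "openin X (V i \<inter> V (j x))" using op opj by (rule openin_Int)
    moreover have "x \<in> V i \<inter> V (j x)" using i(2) J by blast
    ultimately obtain W where W: "openin X W" "path_connectedin X W" "x \<in> W" "W \<subseteq> V i \<inter> V (j x)"
      using lpc unfolding locally_path_connected_space by metis
    obtain e where e: "e \<in> D" "e \<in> W" using dense[OF W(1,3)] by blast
    obtain k where k: "path_between X W k x e" using path_connectedin_path_between[OF W(2,3) e(2)] .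
    have t: "(j x, q x, e) \<in> T" unfolding T_def using J e W(4) by blast
    have ki: "path_between X (V i) k x e" and kj: "path_between X (V (j x)) k x e"
      using path_between_mono[OF k] W(4) by auto
    have \<gamma>t: "path_between X (V (j x)) (\<gamma> (j x, q x, e)) (q x) e" using \<gamma>[OF t] by simp
    have hx: "path_between X (V (j x)) (h x) x (q x)" using J by blast
    have "path_chain (\<gamma> (j x, q x, e)) - (path_chain (h x) + path_chain (\<gamma> (j x, q x, e)) - path_chain k) \<in> G"
      by (intro G_diff G_\<gamma>[OF t] G_bd null_loops_triangle[OF nul hx \<gamma>t kj])
    then have "path_chain k - path_chain (h x) \<in> G" by simp
    then show ?thesis using ki e W(4) by blast
  qed
  \<comment> \<open>Two triangles in \<open>V i\<close> share the side \<open>f\<close> from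
    \<open>g 0\<close> to \<open>e'\<close>: one consists of \<open>g\<close> and the tail
    \<open>k'\<close>, the other of the tail \<open>k\<close> and the chosen arc from
    \<open>e\<close> to \<open>e'\<close>.\<close>
  have small: "path_chain g - path_chain (h (g 0)) + path_chain (h (g 1)) \<in> G"
    if i: "i \<in> I" and g: "pathin X g" "g ` {0..1} \<subseteq> V i" for i g
  proof -
    have nul: "null_loops X (V i)" using V[OF i] unfolding nice_def by blast
    have g': "path_between X (V i) g (g 0) (g 1)" using g unfolding path_between_def by blast
    have "g 0 \<in> V i" "g 1 \<in> V i" using g(2) by auto
    then obtain e k e' k' where e: "e \<in> D \<inter> V i" "path_between X (V i) k (g 0) e" "path_chain k - path_chain (h (g 0)) \<in> G"
      and e': "e' \<in> D \<inter> V i" "path_between X (V i) k' (g 1) e'" "path_chain k' - path_chain (h (g 1)) \<in> G"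
      using tail[OF i] by metis
    have t: "(i, e, e') \<in> T" unfolding T_def using i e(1) e'(1) by blast
    have \<gamma>t: "path_between X (V i) (\<gamma> (i, e, e')) e e'" using \<gamma>[OF t] by simp
    obtain f where f: "path_between X (V i) f (g 0) e'" using path_between_join[OF g' e'(2)] .
    have "(path_chain g + path_chain k' - path_chain f) - (path_chain k + path_chain (\<gamma> (i, e, e')) - path_chain f)
        + path_chain (\<gamma> (i, e, e')) + (path_chain k - path_chain (h (g 0))) - (path_chain k' - path_chain (h (g 1))) \<in> G"
      by (intro G_diff G_add G_\<gamma>[OF t] e(3) e'(3) G_bd null_loops_triangle[OF nul g' e'(2) f]
          null_loops_triangle[OF nul e(2) \<gamma>t f])
    then show ?thesis by (simp add: algebra_simps)
  qed
  have path: "path_chain g - path_chain (h (g 0)) + path_chain (h (g 1)) \<in> G" if g: "pathin X g" for g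
  proof -
    \<comment> \<open>The guard restricts the claim to subintervals of the unit interval, whereas
      the bisection principle also considers intervals sticking out of it.\<close>
    define P where "P a b \<longleftrightarrow> (0 \<le> a \<and> b \<le> 1 \<longrightarrow> frag_of (seg g a b) - path_chain (h (g a)) + path_chain (h (g b)) \<in> G)"
      for a b :: real
    have "P 0 1"
    proof (rule Bolzano)
      show "P a c" if "P a b" "P b c" "a \<le> b" "b \<le> c" for a b c
        unfolding P_def
      proof
        assume ac: "0 \<le> a \<and> c \<le> 1"
        have ab: "a \<in> {0..1}" "b \<in> {0..1}" "c \<in> {0..1}" using ac that by auto
        have Pab: "frag_of (seg g a b) - path_chain (h (g a)) + path_chain (h (g b)) \<in> G"
          and Pbc: "frag_of (seg g b c) - path_chain (h (g b)) + path_chain (h (g c)) \<in> G"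
          using that ac unfolding P_def by auto
        have "(frag_of (seg g a b) - path_chain (h (g a)) + path_chain (h (g b))) +
            (frag_of (seg g b c) - path_chain (h (g b)) + path_chain (h (g c))) -
            (frag_of (seg g a b) + frag_of (seg g b c) - frag_of (seg g a c)) \<in> G"
          by (intro G_diff G_add Pab Pbc G_bd singular_boundary_seg_triangle[OF g ab])
        then show "frag_of (seg g a c) - path_chain (h (g a)) + path_chain (h (g c)) \<in> G"
          by (simp add: algebra_simps)
      qed
      fix x :: real assume x: "0 \<le> x" "x \<le> 1"
      have "g x \<in> topspace X"
        using g x continuous_map_image_subset_topspace unfolding pathin_def by fastforce
      then obtain i where i: "i \<in> I" "g x \<in> V i" using cover by blast
      have "openin X (V i)" using V[OF i(1)] unfolding nice_def by blast
      then have "openin (subtopology euclideanreal {0..1}) {t \<in> topspace (subtopology euclideanreal {0..1}). g t \<in> V i}"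
        using g openin_continuous_map_preimage unfolding pathin_def by blast
      moreover have "x \<in> {t \<in> topspace (subtopology euclideanreal {0..1}). g t \<in> V i}" using x i(2) by simp
      ultimately obtain \<delta> where \<delta>: "\<delta> > 0" "\<And>t. t \<in> {0..1} \<Longrightarrow> dist t x < \<delta> \<Longrightarrow> g t \<in> V i"
        unfolding openin_euclidean_subtopology_iff by auto
      have "P a b" if "a \<le> x" "x \<le> b" "b - a < \<delta>" for a b
        unfolding P_def
      proof
        assume ab01: "0 \<le> a \<and> b \<le> 1"
        have ab: "a \<in> {0..1}" "b \<in> {0..1}" using ab01 that by auto
        have img: "(\<lambda>t. g ((1 - t) * a + t * b)) ` {0..1} \<subseteq> V i"
        proof
          fix y assume "y \<in> (\<lambda>t. g ((1 - t) * a + t * b)) ` {0..1}"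
          then obtain t where t: "t \<in> {0..1}" "y = g ((1 - t) * a + t * b)" by blast
          define s where "s = t * (b - a)"
          have "s \<le> 1 * (b - a)" "0 \<le> s"
            unfolding s_def using t(1) that by (intro mult_right_mono mult_nonneg_nonneg; simp)+
          moreover have "(1 - t) * a + t * b = a + s" by (simp add: s_def algebra_simps)
          ultimately have "dist ((1 - t) * a + t * b) x < \<delta>"
            unfolding dist_real_def using that by (simp add: abs_less_iff)
          then show "y \<in> V i"
            unfolding t(2) by (rule \<delta>(2)[OF convex_combination_unit_interval[OF ab t(1)]])
        qed
        show "frag_of (seg g a b) - path_chain (h (g a)) + path_chain (h (g b)) \<in> G"
          using small[OF i(1) pathin_seg[OF g ab] img] by (simp add: seg_def)
      qed
      then show "\<exists>\<delta>>0. \<forall>a b. a \<le> x \<and> x \<le> b \<and> b - a < \<delta> \<longrightarrow> P a b" using \<delta>(1) by blast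
    qed simp
    then show ?thesis unfolding P_def seg_0_1 by simp
  qed
  \<comment> \<open>\<open>\<eta>\<close> turns a 0-simplex into the tail of its point, read off at
    the only vertex of the standard 0-simplex. For a cycle the correction is
    \<open>\<eta> 0 = 0\<close>, so cycles themselves lie in \<open>G\<close>.\<close>
  define \<eta> where "\<eta> = frag_extend (\<lambda>\<tau>. path_chain (h (\<tau> (\<lambda>i::nat. if i = 0 then 1 else 0 :: real))))"
  have vertex: "(\<lambda>i::nat. if i = 0 then 1 else 0 :: real) \<in> standard_simplex 0" by (simp add: standard_simplex_def)
  have chain: "c + \<eta> (chain_boundary 1 c) \<in> G" if "singular_chain 1 X c" for c
    using that unfolding singular_chain_def
  proof (induction c rule: frag_induction)
    case zero
    then show ?case using G_bd[OF singular_boundary_0] by (simp add: chain_boundary_def \<eta>_def)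
  next
    case (one \<sigma>)
    then obtain g where g: "pathin X g" "\<sigma> = path_simplex g" using singular_simplex_1_path by blast
    have eq: "\<eta> (chain_boundary 1 (path_chain g)) = path_chain (h (g 1)) - path_chain (h (g 0))"
      unfolding chain_boundary_path_simplex \<eta>_def frag_extend_diff frag_extend_of
      by (simp add: vertex)
    show ?case using path[OF g(1)] unfolding g(2) eq by (simp add: algebra_simps)
  next
    case (diff a b)
    then have "(a + \<eta> (chain_boundary 1 a)) - (b + \<eta> (chain_boundary 1 b)) \<in> G" by (rule G_diff)
    moreover have eq: "\<eta> (chain_boundary 1 (a - b)) = \<eta> (chain_boundary 1 a) - \<eta> (chain_boundary 1 b)"
      by (simp add: chain_boundary_def \<eta>_def frag_extend_diff)
    ultimately show ?case unfolding eq by (simp add: algebra_simps)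
  qed
  have "carrier (homology_group 1 X) \<lesssim> carrier (free_Abelian_group T)"
  proof (rule homology_group_lepoll[where R = "\<lambda>s c. singular_boundary 1 X (c - \<Gamma> s)"])
    fix c assume c: "singular_cycle 1 X c"
    then have "c + \<eta> 0 \<in> G" using chain[of c] unfolding singular_cycle_def by metis
    then show "\<exists>s\<in>carrier (free_Abelian_group T). singular_boundary 1 X (c - \<Gamma> s)"
      unfolding G_def \<eta>_def by auto
  next
    fix s a b assume "singular_boundary 1 X (a - \<Gamma> s)" "singular_boundary 1 X (b - \<Gamma> s)"
    from singular_boundary_diff[OF this] show "singular_boundary 1 X (a - b)" by simp
  qed
  also have "\<dots> \<lesssim> K"
  proof (rule free_Abelian_group_lepoll[OF K])
    have "I \<lesssim> D \<times> (UNIV :: nat set)" unfolding I_def by (rule subset_imp_lepoll) blast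
    also have "\<dots> \<lesssim> K" by (intro times_lepoll_infinite countable_lepoll_infinite K D(3)) simp
    finally have I: "I \<lesssim> K" .
    have "T \<lesssim> I \<times> (D \<times> D)" unfolding T_def by (rule subset_imp_lepoll) blast
    also have "\<dots> \<lesssim> K" by (intro times_lepoll_infinite K I D(3))
    finally show "T \<lesssim> K" .
  qed
  finally show ?thesis .
qed

theorem theorem4p2:
  fixes K :: "'k set" and X :: "'a topology"
  assumes "infinite K"
    and "K \<prec> (UNIV :: real set)"
    and "BP K"
    and "kappa_polish K X"
    and "connected_space X"
    and "locally_path_connected_space X"
  shows "carrier (homology_group 1 X) \<lesssim> K \<or> carrier (homology_group 1 X) \<approx> (UNIV :: real set)"
proof (cases "\<forall>x\<in>topspace X. \<exists>U. openin X U \<and> x \<in> U \<and> null_loops X U")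
  case True
  then show ?thesis
    using homology_group_1_lepoll_small_loops[OF assms(1,4,6)] by blast
next
  case False
  then obtain x where x: "x \<in> topspace X" "\<And>U. openin X U \<Longrightarrow> x \<in> U \<Longrightarrow> \<not> null_loops X U" by blast
  have "(UNIV :: real set) \<lesssim> carrier (homology_group 1 X)"
  proof (rule small_essential_loops_continuum[OF assms(1,3,4) x(1)])
    fix U assume "openin X U" "x \<in> U"
    \<comment> \<open>The essential loop is sought in a path-connected \<open>W\<close>, inside
      which it can be moved to the base point \<open>x\<close>.\<close>
    then obtain W where W: "openin X W" "path_connectedin X W" "x \<in> W" "W \<subseteq> U"
      using assms(6) unfolding locally_path_connected_space by metis
    obtain g where "path_between X W g x x" "\<not> singular_boundary 1 X (path_chain g)"
      using essential_loop_at_base[OF W(2,3) x(2)[OF W(1,3)]] .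
    then show "\<exists>g. pathin X g \<and> g ` {0..1} \<subseteq> U \<and> g 0 = x \<and> g 1 = x \<and> \<not> singular_boundary 1 X (path_chain g)"
      using W(4) unfolding path_between_def by blast
  qed
  moreover have "carrier (homology_group 1 X) \<lesssim> (UNIV :: real set)"
    using homology_group_1_lepoll_real[OF assms(1) _ assms(4)] assms(2) unfolding lesspoll_def by blast
  ultimately show ?thesis using lepoll_antisym by blast
qed

end
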